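(* Let $\mathfrak k$ be a field and $s\in\mathfrak k^*$. (1) Let $A$ be a unital associative $\mathfrak k$-algebra with elements $\sigma_k(x)\in A$ ($k\ge 1$, $x\in X$), where $X\subset \mathfrak k^*$ contains $s^j$ for all $j\ge 1$, satisfying the trigonometric Yang–Baxter equation $$\sigma_{k+1}(x)\sigma_{k}(xy)\sigma_{k+1}(y)=\sigma_{k}(y)\sigma_{k+1}(xy)\sigma_{k}(x)\qquad (x,y,xy\in X,\ k\ge 1)$$ and the locality condition $\sigma_k(x)\sigma_l(y)=\sigma_l(y)\sigma_k(x)$ for $|k-l|>1$. Then the multiplicative shuffles ${}^{s}\mathrm{Sh}_{m,n}$ (defined in the context) satisfy $${}^{s}\mathrm{Sh}_{n+k,m}\;({}^{s}\mathrm{Sh}_{k,n})^{\uparrow m}={}^{s}\mathrm{Sh}_{k,m+n}\;{}^{s}\mathrm{Sh}_{n,m}\qquad\text{for all } m,n,k\in\mathbb Z_{\ge 0}.$$ (2) Let $V$ be a $\mathfrak k$-vector space, let $X\subset\mathfrak k^*$ contain $s^j$ for all $j\ge 1$, and suppose the $\sigma_k(x)$ are given by a local representation: $\sigma_k(x)=\mathrm{Id}^{\otimes(k-1)}\otimes\sigma(x)$ (tensored with identities on the right) for a family $\sigma(x)\in\mathrm{End}(V\otimes V)$, $x\in X$, such that the trigonometric Yang–Baxter equation $\sigma_{k+1}(x)\sigma_{k}(xy)\sigma_{k+1}(y)=\sigma_{k}(y)\sigma_{k+1}(xy)\sigma_{k}(x)$ holds for all $k\ge 1$ and all $x,y\in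 X$ with $xy\in X$. For $u\in V^{\otimes m}$ and $v\in V^{\otimes n}$ put $$u\odot v:={}^{s}\mathrm{Sh}_{n,m}(u\otimes v)\in V^{\otimes(m+n)}.$$ Then $\bigoplus_{j\ge 0}V^{\otimes j}$ with the product $\odot$ is an associative graded algebra with identity element $1\in\mathfrak k=V^{\otimes 0}$, and $\bigoplus_{j\ge 0}\mathrm{Im}({}^{s}\Sigma_j)$ is a graded subalgebra of it.
   Context: For $m,n\ge 1$ the multiplicative shuffle is the ordered product $${}^{s}\mathrm{Sh}_{m,n}=\Bigl(\sigma_m(s)\sigma_{m+1}(s^2)\cdots\sigma_{m+n-1}(s^n)\Bigr)\Bigl(\sigma_{m-1}(s^2)\sigma_m(s^3)\cdots\sigma_{m+n-2}(s^{n+1})\Bigr)\cdots\Bigl(\sigma_1(s^m)\sigma_2(s^{m+1})\cdots\sigma_n(s^{m+n-1})\Bigr),$$ i.e. the product over $i=1,\dots,m$ (from left to right) of the brackets $\sigma_{m+1-i}(s^{i})\sigma_{m+2-i}(s^{i+1})\cdots\sigma_{m+n-i}(s^{n+i-1})$; and ${}^{s}\mathrm{Sh}_{m,0}={}^{s}\mathrm{Sh}_{0,m}=1$. Further ${}^{s}\Sigma_0={}^{s}\Sigma_1=1$ and $${}^{s}\Sigma_m=\Bigl(\sigma_1(s)\sigma_2(s^2)\cdots\sigma_{m-1}(s^{m-1})\Bigr)\Bigl(\sigma_1(s)\cdots\sigma_{m-2}(s^{m-2})\Bigr)\cdots\Bigl(\sigma_1(s)\Bigr)\qquad (m\ge 2).$$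 For an expression $w$ in the $\sigma_k(x)$, $w^{\uparrow \ell}$ denotes the same expression with every $\sigma_k(x)$ replaced by $\sigma_{k+\ell}(x)$. In a local representation, ${}^{s}\mathrm{Sh}_{m,n}$ is regarded as an operator on $V^{\otimes(m+n)}$ and ${}^{s}\Sigma_m$ as an operator on $V^{\otimes m}$. The algebras in (2) are called b-shuffle algebras. *)

theory Defs
  imports Complex_Main "HOL-Library.Function_Algebras"
begin

text \<open>Words in the letters \<open>\<sigma>\<^sub>k(x)\<close>, with \<open>(k, x)\<close> standing for \<open>\<sigma>\<^sub>k(x)\<close>. The \<open>j\<close>-th letter of the
  \<open>i\<close>-th bracket of the shuffle is \<open>\<sigma>\<close> with index \<open>m + j - i\<close> and argument \<open>s\<close> to the power
  \<open>i + j - 1\<close>; as \<open>1 \<le> i \<le> m\<close> and \<open>1 \<le> j\<close>, neither subtraction truncates.\<close>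

definition shuffle_word :: "'k::monoid_mult \<Rightarrow> nat \<Rightarrow> nat \<Rightarrow> (nat \<times> 'k) list" where
  "shuffle_word s m n =
     concat (map (\<lambda>i. map (\<lambda>j. (m + j - i, s ^ (i + j - 1))) [1..<Suc n]) [1..<Suc m])"

definition Sigma_word :: "'k::monoid_mult \<Rightarrow> nat \<Rightarrow> (nat \<times> 'k) list" where
  "Sigma_word s m = concat (map (\<lambda>r. map (\<lambda>j. (j, s ^ j)) [1..<r]) (rev [2..<Suc m]))"

definition shift_word :: "nat \<Rightarrow> (nat \<times> 'k) list \<Rightarrow> (nat \<times> 'k) list" where
  "shift_word l w = map (\<lambda>(k, x). (k + l, x)) w"

definition word_prod :: "(nat \<Rightarrow> 'k \<Rightarrow> 'a::monoid_mult) \<Rightarrow> (nat \<times> 'k) list \<Rightarrow> 'a" where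
  "word_prod \<sigma> w = prod_list (map (\<lambda>(k, x). \<sigma> k x) w)"

text \<open>The same for operators, multiplied by composition: the rightmost letter acts first.\<close>

definition word_op :: "(nat \<Rightarrow> 'k \<Rightarrow> 'a \<Rightarrow> 'a) \<Rightarrow> (nat \<times> 'k) list \<Rightarrow> 'a \<Rightarrow> 'a" where
  "word_op \<sigma> w = foldr (\<lambda>(k, x). \<sigma> k x) w"

text \<open>The sort \<open>{ring, monoid_mult}\<close> is that of unital associative rings; unlike \<open>ring_1\<close> it admits
  the zero ring.\<close>

locale unital_algebra = vector_space scale
  for scale :: "'k::field \<Rightarrow> 'a::{ring, monoid_mult} \<Rightarrow> 'a" +
  assumes scale_mult_left: "scale c a * b = scale c (a * b)"
    and scale_mult_right: "a * scale c b = scale c (a * b)"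

text \<open>An algebra on a subspace \<open>A\<close> of an ambient vector space, graded by the subspaces \<open>G i\<close>.\<close>

locale graded_algebra = vector_space scale
  for scale :: "'k::field \<Rightarrow> 'a::ab_group_add \<Rightarrow> 'a" +
  fixes A :: "'a set" and G :: "nat \<Rightarrow> 'a set"
    and mult :: "'a \<Rightarrow> 'a \<Rightarrow> 'a" and one :: 'a
  assumes subspace_A: "subspace A"
    and subspace_G: "subspace (G i)"
    and G_subset: "G i \<subseteq> A"
    and decomposition: "a \<in> A \<Longrightarrow>
      \<exists>!c. (\<forall>i. c i \<in> G i) \<and> finite {i. c i \<noteq> 0} \<and> a = (\<Sum>i | c i \<noteq> 0. c i)"
    and mult_closed: "a \<in> A \<Longrightarrow> b \<in> A \<Longrightarrow> mult a b \<in> A"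
    and mult_add_left: "a \<in> A \<Longrightarrow> a' \<in> A \<Longrightarrow> b \<in> A \<Longrightarrow> mult (a + a') b = mult a b + mult a' b"
    and mult_add_right: "a \<in> A \<Longrightarrow> b \<in> A \<Longrightarrow> b' \<in> A \<Longrightarrow> mult a (b + b') = mult a b + mult a b'"
    and mult_scale_left: "a \<in> A \<Longrightarrow> b \<in> A \<Longrightarrow> mult (scale c a) b = scale c (mult a b)"
    and mult_scale_right: "a \<in> A \<Longrightarrow> b \<in> A \<Longrightarrow> mult a (scale c b) = scale c (mult a b)"
    and mult_assoc: "a \<in> A \<Longrightarrow> b \<in> A \<Longrightarrow> d \<in> A \<Longrightarrow> mult (mult a b) d = mult a (mult b d)"
    and mult_graded: "a \<in> G i \<Longrightarrow> b \<in> G j \<Longrightarrow> mult a b \<in> G (i + j)"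
    and one_in: "one \<in> G 0"
    and one_left: "a \<in> A \<Longrightarrow> mult one a = a"
    and one_right: "a \<in> A \<Longrightarrow> mult a one = a"

definition graded_subalgebra ::
    "('k::field \<Rightarrow> 'a::ab_group_add \<Rightarrow> 'a) \<Rightarrow> 'a set \<Rightarrow> (nat \<Rightarrow> 'a set) \<Rightarrow>
     'a set \<Rightarrow> (nat \<Rightarrow> 'a set) \<Rightarrow> ('a \<Rightarrow> 'a \<Rightarrow> 'a) \<Rightarrow> 'a \<Rightarrow> bool" where
  "graded_subalgebra scale B H A G mult one \<longleftrightarrow>
     B \<subseteq> A \<and> (\<forall>i. H i = B \<inter> G i) \<and>
     graded_algebra scale A G mult one \<and> graded_algebra scale B H mult one"

definition fun_scale :: "('k \<Rightarrow> 'b \<Rightarrow> 'b) \<Rightarrow> 'k \<Rightarrow> ('a \<Rightarrow> 'b) \<Rightarrow> 'a \<Rightarrow> 'b" where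
  "fun_scale scale c f = (\<lambda>x. scale c (f x))"

lemma vector_space_fun_scale:
  assumes "vector_space scale"
  shows "vector_space (fun_scale scale)"
proof -
  interpret vector_space scale by fact
  show ?thesis
    by unfold_locales (auto simp: fun_scale_def fun_eq_iff scale_right_distrib scale_left_distrib)
qed

text \<open>External direct sum of a sequence of subspaces, and its summands.\<close>

definition direct_sum :: "(nat \<Rightarrow> 'a::zero set) \<Rightarrow> (nat \<Rightarrow> 'a) set" where
  "direct_sum P = {w. (\<forall>j. w j \<in> P j) \<and> finite {j. w j \<noteq> 0}}"

definition homog :: "nat \<Rightarrow> 'a::zero \<Rightarrow> nat \<Rightarrow> 'a" where
  "homog i t = (\<lambda>j. if j = i then t else 0)"

text \<open>Tensor powers of a vector space \<open>V\<close> (the type \<open>'v\<close> with scalar multiplication \<open>scale\<close>).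
  The pure tensor of \<open>v\<^sub>1, \<dots>, v\<^sub>n\<close> is realised as evaluation of \<open>n\<close>-linear forms at
  \<open>(v\<^sub>1, \<dots>, v\<^sub>n)\<close>, and the \<open>n\<close>-th tensor power is the span of the pure tensors of length \<open>n\<close>.
  Over a field this is the tensor power for every \<open>V\<close>, of finite dimension or not:
  see \<open>tensor_power_universal\<close> below. In degree \<open>0\<close> it is the line spanned by the empty
  pure tensor, which is \<open>1\<close> under the identification with the ground field.\<close>

definition multilinear :: "('k::field \<Rightarrow> 'v::ab_group_add \<Rightarrow> 'v) \<Rightarrow>
    ('k \<Rightarrow> 'w::ab_group_add \<Rightarrow> 'w) \<Rightarrow> nat \<Rightarrow> ('v list \<Rightarrow> 'w) \<Rightarrow> bool" where
  "multilinear s1 s2 n F \<longleftrightarrow>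
     (\<forall>vs i. length vs = n \<longrightarrow> i < n \<longrightarrow> Vector_Spaces.linear s1 s2 (\<lambda>v. F (vs[i := v])))"

type_synonym ('k, 'v) tensor = "('v list \<Rightarrow> 'k) \<Rightarrow> 'k"

definition pure_tensor ::
    "('k::field \<Rightarrow> 'v::ab_group_add \<Rightarrow> 'v) \<Rightarrow> 'v list \<Rightarrow> ('k, 'v) tensor" where
  "pure_tensor scale vs = (\<lambda>F. if multilinear scale (*) (length vs) F then F vs else 0)"

abbreviation tensor_scale :: "'k::field \<Rightarrow> ('k, 'v) tensor \<Rightarrow> ('k, 'v) tensor" where
  "tensor_scale \<equiv> fun_scale (*)"

definition tensor_power ::
    "('k::field \<Rightarrow> 'v::ab_group_add \<Rightarrow> 'v) \<Rightarrow> nat \<Rightarrow> ('k, 'v) tensor set" where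
  "tensor_power scale n = module.span tensor_scale (pure_tensor scale ` {vs. length vs = n})"

lemma vector_space_mult: "vector_space ((*) :: 'k::field \<Rightarrow> 'k \<Rightarrow> 'k)"
  by unfold_locales (auto simp: algebra_simps)

interpretation tensor: vector_space "tensor_scale :: 'k::field \<Rightarrow> ('k, 'v) tensor \<Rightarrow> ('k, 'v) tensor"
  by (rule vector_space_fun_scale[OF vector_space_mult])

lemma multilinear_functional:
  assumes "multilinear s1 s2 n M" and "Vector_Spaces.linear s2 s3 g"
  shows "multilinear s1 s3 n (\<lambda>vs. g (M vs))"
  using assms Vector_Spaces.linear_compose[of s1 s2 _ s3 g]
  unfolding multilinear_def comp_def by blast

lemma linear_coordinate:
  "Vector_Spaces.linear tensor_scale (*) (\<lambda>t :: ('k::field, 'v) tensor. t F)"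
  by (simp add: Vector_Spaces.linear_iff vector_space_mult tensor.vector_space_axioms fun_scale_def)

lemma multilinear_pure_tensor:
  assumes "vector_space scale"
  shows "multilinear scale tensor_scale n (pure_tensor scale)"
proof -
  have "Vector_Spaces.linear scale tensor_scale (\<lambda>v. pure_tensor scale (vs[i := v]))"
    if "length vs = n" "i < n" for vs i
  proof -
    have lin: "Vector_Spaces.linear scale (*) (\<lambda>v. F (vs[i := v]))"
      if "multilinear scale (*) (length vs) F" for F
      using that \<open>length vs = n\<close> \<open>i < n\<close> by (auto simp: multilinear_def)
    have a: "pure_tensor scale (vs[i := v + w]) =
        pure_tensor scale (vs[i := v]) + pure_tensor scale (vs[i := w])" for v w
      using lin by (auto simp: pure_tensor_def fun_eq_iff Vector_Spaces.linear_iff)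
    have b: "pure_tensor scale (vs[i := scale c v]) =
        tensor_scale c (pure_tensor scale (vs[i := v]))" for c v
      using lin by (auto simp: pure_tensor_def fun_eq_iff Vector_Spaces.linear_iff fun_scale_def)
    show ?thesis
      using a b assms by (simp add: Vector_Spaces.linear_iff tensor.vector_space_axioms)
  qed
  then show ?thesis by (simp add: multilinear_def)
qed

lemma pure_tensor_in_power: "pure_tensor scale vs \<in> tensor_power scale (length vs)"
  by (auto simp: tensor_power_def intro: tensor.span_base)

lemma tensor_power_universal:
  fixes scale :: "'k::field \<Rightarrow> 'v::ab_group_add \<Rightarrow> 'v"
    and scaleW :: "'k \<Rightarrow> 'w::ab_group_add \<Rightarrow> 'w"
  assumes "vector_space scale" and W: "vector_space scaleW"
    and M: "multilinear scale scaleW n M"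
  shows "\<exists>g. Vector_Spaces.linear tensor_scale scaleW g \<and>
              (\<forall>vs. length vs = n \<longrightarrow> g (pure_tensor scale vs) = M vs)"
    and "Vector_Spaces.linear tensor_scale scaleW g \<Longrightarrow>
         Vector_Spaces.linear tensor_scale scaleW h \<Longrightarrow>
         (\<And>vs. length vs = n \<Longrightarrow> g (pure_tensor scale vs) = M vs) \<Longrightarrow>
         (\<And>vs. length vs = n \<Longrightarrow> h (pure_tensor scale vs) = M vs) \<Longrightarrow>
         t \<in> tensor_power scale n \<Longrightarrow> g t = h t"
proof -
  interpret W: vector_space scaleW by fact
  interpret TW: vector_space_pair "tensor_scale :: 'k \<Rightarrow> ('k, 'v) tensor \<Rightarrow> _" scaleW
    by unfold_locales
  interpret K: vector_space "(*) :: 'k \<Rightarrow> 'k \<Rightarrow> 'k" by (rule vector_space_mult)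
  interpret WK: vector_space_pair scaleW "(*) :: 'k \<Rightarrow> 'k \<Rightarrow> 'k" by unfold_locales
  interpret TK: vector_space_pair "tensor_scale :: 'k \<Rightarrow> ('k, 'v) tensor \<Rightarrow> _" "(*) :: 'k \<Rightarrow> 'k \<Rightarrow> 'k"
    by unfold_locales
  let ?P = "pure_tensor scale ` {vs. length vs = n}"
  show "g t = h t" if "Vector_Spaces.linear tensor_scale scaleW g"
    "Vector_Spaces.linear tensor_scale scaleW h"
    "\<And>vs. length vs = n \<Longrightarrow> g (pure_tensor scale vs) = M vs"
    "\<And>vs. length vs = n \<Longrightarrow> h (pure_tensor scale vs) = M vs"
    "t \<in> tensor_power scale n" for g h
    by (rule TW.linear_eq_on_span[OF that(1,2), of ?P])
      (use that(3-) in \<open>auto simp: tensor_power_def\<close>)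
  obtain B where B: "B \<subseteq> ?P" "tensor.independent B" "?P \<subseteq> tensor.span B"
    using tensor.maximal_independent_subset[of ?P] by blast
  have "\<forall>b\<in>B. \<exists>vs. length vs = n \<and> pure_tensor scale vs = b" using B(1) by auto
  then obtain r where r: "\<And>b. b \<in> B \<Longrightarrow> length (r b) = n \<and> pure_tensor scale (r b) = b"
    unfolding bchoice_iff by blast
  obtain g where g: "Vector_Spaces.linear tensor_scale scaleW g" "\<And>b. b \<in> B \<Longrightarrow> g b = M (r b)"
    using TW.linear_independent_extend[OF B(2), of "\<lambda>b. M (r b)"] by blast
  have "g (pure_tensor scale vs) = M vs" if vs: "length vs = n" for vs
  proof (rule ccontr)
    assume ne: "g (pure_tensor scale vs) \<noteq> M vs"
    define w where "w = g (pure_tensor scale vs) - M vs"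
    have "W.independent {w}" using ne by (simp add: w_def)
    from WK.linear_independent_extend[OF this, of "\<lambda>_. 1"]
    obtain l where l: "Vector_Spaces.linear scaleW (*) l" "l w = 1" by blast
    define F where "F = (\<lambda>vs. l (M vs))"
    have F: "multilinear scale (*) n F" unfolding F_def by (rule multilinear_functional[OF M l(1)])
    have lg: "Vector_Spaces.linear tensor_scale (*) (l \<circ> g)"
      by (rule Vector_Spaces.linear_compose[OF g(1) l(1)])
    have "(l \<circ> g) b = b F" if b: "b \<in> B" for b
    proof -
      have "b F = pure_tensor scale (r b) F" using r[OF b] by simp
      then show ?thesis using g(2)[OF b] r[OF b] F by (simp add: pure_tensor_def F_def)
    qed
    moreover have "pure_tensor scale vs \<in> tensor.span B" using B(3) vs by blast
    ultimately have "(l \<circ> g) (pure_tensor scale vs) = pure_tensor scale vs F"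
      using TK.linear_eq_on_span[OF lg linear_coordinate[of F], of B] by blast
    then have "l (g (pure_tensor scale vs)) = l (M vs)"
      using F vs by (simp add: pure_tensor_def F_def)
    moreover have "l w = l (g (pure_tensor scale vs)) - l (M vs)"
      unfolding w_def by (rule WK.linear_diff[OF l(1)])
    ultimately show False using l(2) by simp
  qed
  with g(1) show "\<exists>g. Vector_Spaces.linear tensor_scale scaleW g \<and>
              (\<forall>vs. length vs = n \<longrightarrow> g (pure_tensor scale vs) = M vs)" by blast
qed

text \<open>The linear map on tensor powers induced by a multilinear map \<open>M\<close> with values in tensors;
  see \<open>tensor_lift_pure\<close>.\<close>

definition tensor_lift ::
    "('v list \<Rightarrow> ('k, 'v) tensor) \<Rightarrow> ('k, 'v) tensor \<Rightarrow> ('k, 'v) tensor" where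
  "tensor_lift M t = (\<lambda>F. t (\<lambda>vs. M vs F))"

lemma tensor_lift_pure:
  assumes "multilinear scale tensor_scale (length vs) M"
  shows "tensor_lift M (pure_tensor scale vs) = M vs"
  using multilinear_functional[OF assms linear_coordinate]
  by (simp add: tensor_lift_def pure_tensor_def fun_eq_iff)

lemma tensor_lift_linear:
  "tensor_lift M 0 = 0" "tensor_lift M (t + u) = tensor_lift M t + tensor_lift M u"
  "tensor_lift M (tensor_scale c t) = tensor_scale c (tensor_lift M t)"
  by (auto simp: tensor_lift_def fun_scale_def fun_eq_iff)

definition tensor_prod :: "('k::field \<Rightarrow> 'v::ab_group_add \<Rightarrow> 'v) \<Rightarrow>
    ('k, 'v) tensor \<Rightarrow> ('k, 'v) tensor \<Rightarrow> ('k, 'v) tensor" where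
  "tensor_prod scale t u =
     tensor_lift (\<lambda>xs. tensor_lift (\<lambda>ys. pure_tensor scale (xs @ ys)) u) t"

definition is_endomorphism ::
    "('k \<Rightarrow> 'a::ab_group_add \<Rightarrow> 'a) \<Rightarrow> 'a set \<Rightarrow> ('a \<Rightarrow> 'a) \<Rightarrow> bool" where
  "is_endomorphism scale S f \<longleftrightarrow>
     (\<forall>x\<in>S. f x \<in> S) \<and> (\<forall>x\<in>S. \<forall>y\<in>S. f (x + y) = f x + f y) \<and>
     (\<forall>c. \<forall>x\<in>S. f (scale c x) = scale c (f x))"

text \<open>\<open>local_op scale f k\<close> is \<open>f\<close> acting in the tensor factors \<open>k\<close> and \<open>k + 1\<close> (counted from \<open>1\<close>),
  on all tensor powers of degree at least \<open>k + 1\<close> at once; see \<open>local_op_pure\<close>.\<close>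

definition local_op :: "('k::field \<Rightarrow> 'v::ab_group_add \<Rightarrow> 'v) \<Rightarrow>
    (('k, 'v) tensor \<Rightarrow> ('k, 'v) tensor) \<Rightarrow> nat \<Rightarrow> ('k, 'v) tensor \<Rightarrow> ('k, 'v) tensor" where
  "local_op scale f k = tensor_lift (\<lambda>vs.
     tensor_prod scale
       (tensor_prod scale (pure_tensor scale (take (k - 1) vs))
          (f (pure_tensor scale (take 2 (drop (k - 1) vs)))))
       (pure_tensor scale (drop (k + 1) vs)))"

lemma multilinear_combination:
  fixes M M' :: "'v::ab_group_add list \<Rightarrow> ('k::field, 'v) tensor"
  assumes "vector_space scale"
    and M: "multilinear scale tensor_scale n M" and M': "multilinear scale tensor_scale n M'"
  shows "multilinear scale tensor_scale n (\<lambda>vs. tensor_scale c (M vs) + M' vs)"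
  unfolding multilinear_def
proof (intro allI impI)
  interpret vector_space_pair scale "tensor_scale :: 'k \<Rightarrow> ('k, 'v) tensor \<Rightarrow> _"
    using assms(1) tensor.vector_space_axioms by (rule vector_space_pair.intro)
  fix vs :: "'v list" and i assume "length vs = n" "i < n"
  then show "Vector_Spaces.linear scale tensor_scale
      (\<lambda>v. tensor_scale c (M (vs[i := v])) + M' (vs[i := v]))"
    using M M' by (intro linear_compose_add linear_compose_scale_right) (simp_all add: multilinear_def)
qed

lemma tensor_prod_left_linear:
  "tensor_prod scale 0 u = 0"
  "tensor_prod scale (t + t') u = tensor_prod scale t u + tensor_prod scale t' u"
  "tensor_prod scale (tensor_scale c t) u = tensor_scale c (tensor_prod scale t u)"
  by (simp_all add: tensor_prod_def tensor_lift_linear)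

lemma multilinear_append:
  fixes scale :: "'k::field \<Rightarrow> 'v::ab_group_add \<Rightarrow> 'v"
  assumes "vector_space scale"
  shows "multilinear scale tensor_scale n (\<lambda>ys. pure_tensor scale (xs @ ys))"
    and "multilinear scale tensor_scale n (\<lambda>xs. pure_tensor scale (xs @ ys))"
proof -
  have *: "\<And>vs i. i < length vs \<Longrightarrow>
      Vector_Spaces.linear scale tensor_scale (\<lambda>v. pure_tensor scale (vs[i := v]))"
    using multilinear_pure_tensor[OF assms] by (auto simp: multilinear_def)
  show "multilinear scale tensor_scale n (\<lambda>ys. pure_tensor scale (xs @ ys))"
    unfolding multilinear_def
  proof (intro allI impI)
    fix vs :: "'v list" and i assume "length vs = n" "i < n"
    then show "Vector_Spaces.linear scale tensor_scale (\<lambda>v. pure_tensor scale (xs @ vs[i := v]))"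
      using *[of "length xs + i" "xs @ vs"] by (simp add: list_update_append)
  qed
  show "multilinear scale tensor_scale n (\<lambda>xs. pure_tensor scale (xs @ ys))"
    unfolding multilinear_def
  proof (intro allI impI)
    fix vs :: "'v list" and i assume "length vs = n" "i < n"
    then show "Vector_Spaces.linear scale tensor_scale (\<lambda>v. pure_tensor scale (vs[i := v] @ ys))"
      using *[of i "vs @ ys"] by (simp add: list_update_append)
  qed
qed

lemma multilinear_zero:
  "vector_space scale \<Longrightarrow> multilinear scale tensor_scale n (\<lambda>_. 0 :: ('k::field, 'v) tensor)"
  by (auto simp: multilinear_def Vector_Spaces.linear_iff tensor.vector_space_axioms fun_scale_def fun_eq_iff)

lemma tensor_power_induct [consumes 1, case_names zero step]:
  assumes "t \<in> tensor_power scale n" "P 0"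
    "\<And>c vs t. length vs = n \<Longrightarrow> t \<in> tensor_power scale n \<Longrightarrow> P t \<Longrightarrow>
       P (tensor_scale c (pure_tensor scale vs) + t)"
  shows "P t"
proof -
  have "t \<in> tensor_power scale n \<and> P t"
    using assms(1)[unfolded tensor_power_def]
  proof (induct rule: tensor.span_induct_alt)
    case base
    then show ?case using assms(2) by (simp add: tensor_power_def tensor.span_zero del: zero_fun_apply)
  next
    case (step c x y)
    then obtain vs where vs: "length vs = n" "x = pure_tensor scale vs" by auto
    have "tensor_scale c x + y \<in> tensor_power scale n"
      using step vs pure_tensor_in_power[of scale vs]
      by (simp add: tensor_power_def tensor.span_add tensor.span_scale)
    then show ?case using step vs assms(3) by blast
  qed
  then show ?thesis ..
qed

lemma multilinear_lift_append:
  assumes V: "vector_space scale" and u: "u \<in> tensor_power scale m"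
  shows "multilinear scale tensor_scale n
           (\<lambda>xs. tensor_lift (\<lambda>ys. pure_tensor scale (xs @ ys)) u)"
  using u
proof (induction rule: tensor_power_induct)
  case zero
  then show ?case by (simp add: tensor_lift_linear multilinear_zero[OF V] del: zero_fun_apply)
next
  case (step c vs t)
  then show ?case
    using multilinear_combination[OF V multilinear_append(2)[OF V] step(3)]
    by (simp add: tensor_lift_linear tensor_lift_pure multilinear_append[OF V] del: plus_fun_apply)
qed

lemma tensor_prod_pure_left:
  assumes "vector_space scale" "u \<in> tensor_power scale m"
  shows "tensor_prod scale (pure_tensor scale xs) u =
         tensor_lift (\<lambda>ys. pure_tensor scale (xs @ ys)) u"
  unfolding tensor_prod_def by (rule tensor_lift_pure[OF multilinear_lift_append[OF assms]])

lemma tensor_prod_pure: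
  assumes "vector_space scale"
  shows "tensor_prod scale (pure_tensor scale xs) (pure_tensor scale ys) =
         pure_tensor scale (xs @ ys)"
  using tensor_prod_pure_left[OF assms pure_tensor_in_power]
    tensor_lift_pure[OF multilinear_append(1)[OF assms]] by simp

lemma tensor_prod_pure_closed:
  assumes V: "vector_space scale" and u: "u \<in> tensor_power scale m"
  shows "tensor_prod scale (pure_tensor scale xs) u \<in> tensor_power scale (length xs + m)"
  unfolding tensor_prod_pure_left[OF assms] using u
proof (induction rule: tensor_power_induct)
  case zero
  then show ?case by (simp add: tensor_lift_linear tensor_power_def tensor.span_zero del: zero_fun_apply)
next
  case (step c vs t)
  then show ?case
    using pure_tensor_in_power[of scale "xs @ vs"]
    by (simp add: tensor_lift_linear tensor_lift_pure multilinear_append[OF V]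
        tensor_power_def tensor.span_add tensor.span_scale del: plus_fun_apply)
qed

lemma multilinear_prod_right:
  assumes V: "vector_space scale" and t: "t \<in> tensor_power scale m"
  shows "multilinear scale tensor_scale n (\<lambda>ys. tensor_prod scale t (pure_tensor scale ys))"
  using t
proof (induction rule: tensor_power_induct)
  case zero
  then show ?case by (simp add: tensor_prod_left_linear multilinear_zero[OF V] del: zero_fun_apply)
next
  case (step c vs t)
  then show ?case
    using multilinear_combination[OF V multilinear_append(1)[OF V] step(3)]
    by (simp add: tensor_prod_left_linear tensor_prod_pure[OF V] del: plus_fun_apply)
qed

lemma local_op_pure:
  assumes V: "vector_space scale"
    and f: "is_endomorphism tensor_scale (tensor_power scale 2) f"
    and k: "1 \<le> k" "k + 1 \<le> length vs"
  shows "local_op scale f k (pure_tensor scale vs) =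
     tensor_prod scale
       (tensor_prod scale (pure_tensor scale (take (k - 1) vs))
          (f (pure_tensor scale [vs ! (k - 1), vs ! k])))
       (pure_tensor scale (drop (k + 1) vs))"
proof -
  let ?T = "\<lambda>vs. pure_tensor scale (take (k - 1) vs)"
  let ?m = "\<lambda>vs. pure_tensor scale (take 2 (drop (k - 1) vs))"
  let ?D = "\<lambda>vs. pure_tensor scale (drop (k + 1) vs)"
  have lin: "\<And>vs i. i < length vs \<Longrightarrow>
      Vector_Spaces.linear scale tensor_scale (\<lambda>v. pure_tensor scale (vs[i := v]))"
    using multilinear_pure_tensor[OF V] by (auto simp: multilinear_def)
  have "Vector_Spaces.linear scale tensor_scale (\<lambda>v.
      tensor_prod scale (tensor_prod scale (?T (us[i := v])) (f (?m (us[i := v])))) (?D (us[i := v])))"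
    if us: "length us = length vs" "i < length vs" for us i
  proof -
    have m2: "length (take 2 (drop (k - 1) us)) = 2" using us k by simp
    have mp: "pure_tensor scale ws \<in> tensor_power scale 2" if "length ws = 2" for ws
      using pure_tensor_in_power[of scale ws] that by simp
    have fp: "f (pure_tensor scale ws) \<in> tensor_power scale 2" if "length ws = 2" for ws
      using mp[OF that] f by (simp add: is_endomorphism_def)
    consider "i < k - 1" | "k - 1 \<le> i" "i < k + 1" | "k + 1 \<le> i" by linarith
    then show ?thesis
    proof cases
      case 1
      then have e: "take (k - 1) (us[i := v]) = (take (k - 1) us)[i := v]"
        "take 2 (drop (k - 1) (us[i := v])) = take 2 (drop (k - 1) us)"
        "drop (k + 1) (us[i := v]) = drop (k + 1) us" for v
        by (simp_all add: take_update_swap drop_update_cancel)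
      show ?thesis unfolding e
        using lin[of i "take (k - 1) us"] 1 us k
        by (simp add: Vector_Spaces.linear_iff tensor_prod_left_linear)
    next
      case 2
      let ?q = "take 2 (drop (k - 1) us)" and ?j = "i - (k - 1)"
      from 2 have e: "take (k - 1) (us[i := v]) = take (k - 1) us"
        "take 2 (drop (k - 1) (us[i := v])) = ?q[?j := v]"
        "drop (k + 1) (us[i := v]) = drop (k + 1) us" for v
        by (simp_all add: drop_update_swap take_update_swap[of 2])
      have j: "?j < length ?q" using 2 m2 k by linarith
      have "Vector_Spaces.linear scale tensor_scale (\<lambda>v. f (pure_tensor scale (?q[?j := v])))"
        using lin[OF j] f mp[of "?q[?j := _]"] m2
        by (simp add: Vector_Spaces.linear_iff is_endomorphism_def)
      then show ?thesis unfolding e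
        using fp[of "?q[?j := _]"] m2
        by (simp add: Vector_Spaces.linear_iff tensor_prod_left_linear tensor_prod_pure_left[OF V fp]
            tensor_lift_linear)
    next
      case 3
      then have e: "take (k - 1) (us[i := v]) = take (k - 1) us"
        "take 2 (drop (k - 1) (us[i := v])) = take 2 (drop (k - 1) us)"
        "drop (k + 1) (us[i := v]) = (drop (k + 1) us)[i - (k + 1) := v]" for v
        using k by (simp_all add: drop_update_swap)
      have "tensor_prod scale (?T us) (f (?m us)) \<in> tensor_power scale (length (take (k - 1) us) + 2)"
        by (rule tensor_prod_pure_closed[OF V fp[OF m2]])
      from multilinear_prod_right[OF V this, of "length (drop (k + 1) us)"] show ?thesis
        unfolding e using 3 us by (simp add: multilinear_def)
    qed
  qed
  then have "multilinear scale tensor_scale (length vs)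
      (\<lambda>vs. tensor_prod scale (tensor_prod scale (?T vs) (f (?m vs))) (?D vs))"
    by (simp add: multilinear_def)
  from tensor_lift_pure[OF this]
  have "local_op scale f k (pure_tensor scale vs) =
      tensor_prod scale (tensor_prod scale (?T vs) (f (?m vs))) (?D vs)"
    by (simp add: local_op_def)
  moreover have "take 2 (drop (k - 1) vs) = [vs ! (k - 1), vs ! k]"
    using k by (simp add: numeral_2_eq_2 take_Suc_conv_app_nth)
  ultimately show ?thesis by simp
qed

text \<open>The product of \<open>u\<close> in degree \<open>m\<close> and \<open>v\<close> in degree \<open>n\<close>, and its bilinear extension to
  the direct sum.\<close>

definition bshuffle_homog :: "('k::field \<Rightarrow> 'v::ab_group_add \<Rightarrow> 'v) \<Rightarrow>
    ('k \<Rightarrow> ('k, 'v) tensor \<Rightarrow> ('k, 'v) tensor) \<Rightarrow> 'k \<Rightarrow> nat \<Rightarrow> nat \<Rightarrow>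
    ('k, 'v) tensor \<Rightarrow> ('k, 'v) tensor \<Rightarrow> ('k, 'v) tensor" where
  "bshuffle_homog scale \<sigma> s m n u v =
     word_op (\<lambda>k x. local_op scale (\<sigma> x) k) (shuffle_word s n m) (tensor_prod scale u v)"

definition bshuffle :: "('k::field \<Rightarrow> 'v::ab_group_add \<Rightarrow> 'v) \<Rightarrow>
    ('k \<Rightarrow> ('k, 'v) tensor \<Rightarrow> ('k, 'v) tensor) \<Rightarrow> 'k \<Rightarrow>
    (nat \<Rightarrow> ('k, 'v) tensor) \<Rightarrow> (nat \<Rightarrow> ('k, 'v) tensor) \<Rightarrow> nat \<Rightarrow> ('k, 'v) tensor" where
  "bshuffle scale \<sigma> s u v =
     (\<lambda>N. \<Sum>m\<le>N. bshuffle_homog scale \<sigma> s m (N - m) (u m) (v (N - m)))"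

definition Sigma_image :: "('k::field \<Rightarrow> 'v::ab_group_add \<Rightarrow> 'v) \<Rightarrow>
    ('k \<Rightarrow> ('k, 'v) tensor \<Rightarrow> ('k, 'v) tensor) \<Rightarrow> 'k \<Rightarrow> nat \<Rightarrow> ('k, 'v) tensor set" where
  "Sigma_image scale \<sigma> s j =
     word_op (\<lambda>k x. local_op scale (\<sigma> x) k) (Sigma_word s j) ` tensor_power scale j"

end

theory Submission
  imports Defs
begin

text \<open>Read a word in the letters \<open>\<sigma>\<^sub>k(x)\<close> as a braid whose crossings carry spectral parameters. A
  shuffle word is then a bundle of strands crossing another bundle, and the shuffle identity
  compares two ways of crossing three bundles \<open>M\<close>, \<open>N\<close>, \<open>K\<close>. Moving a single strand of \<open>K\<close> past a
  single strand of \<open>N\<close> across the bundle \<open>M\<close> needs one Yang-Baxter move for each strand of \<open>M\<close>;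
  induction on the sizes of \<open>N\<close> and of \<open>K\<close> then gives the identity already for words, modulo
  Yang-Baxter moves and commutation of distant letters.

  In a local representation the shuffle identity is associativity of the product. Since
  \<open>\<Sigma>\<^bsub>m+1\<^esub> = Sh\<^bsub>1,m\<^esub> \<Sigma>\<^bsub>m\<^esub>\<close>, it also gives \<open>\<Sigma>\<^bsub>m+n\<^esub> = Sh\<^bsub>n,m\<^esub> (\<Sigma>\<^bsub>m\<^esub> \<otimes> \<Sigma>\<^bsub>n\<^esub>)\<close> by induction on \<open>n\<close>,
  which is closure of the images under the product.\<close>

section \<open>Words\<close>

lemma shift_word_simps [simp]:
  "shift_word l [] = []"
  "shift_word l ((k, x) # w) = (k + l, x) # shift_word l w"
  "shift_word l (v @ w) = shift_word l v @ shift_word l w"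
  "shift_word l (shift_word m w) = shift_word (m + l) w"
  by (simp_all add: shift_word_def split_beta add.assoc)

lemma set_shift_word_subset:
  "set w \<subseteq> {a..<b} \<times> X \<Longrightarrow> set (shift_word l w) \<subseteq> {a + l..<b + l} \<times> X"
  by (auto simp: shift_word_def)

lemma word_prod_simps [simp]:
  "word_prod \<tau> [] = 1"
  "word_prod \<tau> ((k, x) # w) = \<tau> k x * word_prod \<tau> w"
  "word_prod \<tau> (v @ w) = word_prod \<tau> v * word_prod \<tau> w"
  by (simp_all add: word_prod_def)

lemma word_op_simps [simp]:
  "word_op \<phi> [] t = t"
  "word_op \<phi> ((k, x) # w) t = \<phi> k x (word_op \<phi> w t)"
  "word_op \<phi> (v @ w) t = word_op \<phi> v (word_op \<phi> w t)"
  by (simp_all add: word_op_def)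

definition bracket :: "'k::monoid_mult \<Rightarrow> nat \<Rightarrow> nat \<Rightarrow> nat \<Rightarrow> (nat \<times> 'k) list" where
  "bracket s a p n = map (\<lambda>j. (a + j, s ^ (p + j))) [0..<n]"

lemma bracket_0 [simp]: "bracket s a p 0 = []"
  by (simp add: bracket_def)

lemma bracket_Suc: "bracket s a p (Suc n) = bracket s a p n @ [(a + n, s ^ (p + n))]"
  by (simp add: bracket_def)

lemma bracket_add: "bracket s a p (m + n) = bracket s a p m @ bracket s (a + m) (p + m) n"
  by (induction n) (simp_all add: bracket_Suc add.assoc)

lemma bracket_Suc_left: "bracket s a p (Suc n) = (a, s ^ p) # bracket s (Suc a) (Suc p) n"
  using bracket_add[of s a p 1 n] by (simp add: bracket_def)

lemma shift_word_bracket [simp]: "shift_word l (bracket s a p n) = bracket s (a + l) p n"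
  by (simp add: bracket_def shift_word_def)

lemma shuffle_word_0 [simp]: "shuffle_word s 0 n = []" "shuffle_word s m 0 = []"
  by (simp_all add: shuffle_word_def)

lemma shuffle_word_Suc:
  "shuffle_word s (Suc m) n = shift_word 1 (shuffle_word s m n) @ bracket s 1 (Suc m) n"
proof -
  have "map (\<lambda>j. (Suc m + j - Suc m, s ^ (Suc m + j - 1))) [1..<Suc n] = bracket s 1 (Suc m) n"
    by (rule nth_equalityI) (auto simp: bracket_def simp del: upt_Suc)
  moreover have "shift_word 1 (shuffle_word s m n) =
      concat (map (\<lambda>i. map (\<lambda>j. (Suc m + j - i, s ^ (i + j - 1))) [1..<Suc n]) [1..<Suc m])"
    by (auto simp: shuffle_word_def shift_word_def map_concat comp_def simp del: upt_Suc
        intro!: arg_cong[where f = concat] map_cong)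
  ultimately show ?thesis
    by (simp add: shuffle_word_def)
qed

lemma Sigma_word_0 [simp]: "Sigma_word s 0 = []"
  by (simp add: Sigma_word_def)

lemma Sigma_word_Suc: "Sigma_word s (Suc m) = shuffle_word s 1 m @ Sigma_word s m"
proof (cases "m = 0")
  case False
  have "map (\<lambda>j. (j, s ^ j)) [1..<Suc m] = bracket s 1 1 m"
    by (rule nth_equalityI) (auto simp: bracket_def simp del: upt_Suc)
  then show ?thesis
    using False shuffle_word_Suc[of s 0 m] by (simp add: Sigma_word_def)
qed (simp add: Sigma_word_def)

section \<open>Words modulo Yang-Baxter moves\<close>

context
  fixes X :: "'k::monoid_mult set"
begin

inductive yb_equiv :: "(nat \<times> 'k) list \<Rightarrow> (nat \<times> 'k) list \<Rightarrow> bool"  (infix "\<approx>" 50)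
  where
    yb_refl [simp]: "w \<approx> w"
  | yb_sym: "v \<approx> w \<Longrightarrow> w \<approx> v"
  | yb_trans [trans]: "u \<approx> v \<Longrightarrow> v \<approx> w \<Longrightarrow> u \<approx> w"
  | yb_append: "v \<approx> v' \<Longrightarrow> w \<approx> w' \<Longrightarrow> v @ w \<approx> v' @ w'"
  | yang_baxter: "1 \<le> k \<Longrightarrow> x \<in> X \<Longrightarrow> y \<in> X \<Longrightarrow> x * y \<in> X \<Longrightarrow>
      [(k + 1, x), (k, x * y), (k + 1, y)] \<approx> [(k, y), (k + 1, x * y), (k, x)]"
  | far_commute: "1 \<le> k \<Longrightarrow> k + 1 < l \<Longrightarrow> x \<in> X \<Longrightarrow> y \<in> X \<Longrightarrow> [(k, x), (l, y)] \<approx> [(l, y), (k, x)]"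

lemma yb_equiv_context: "v \<approx> v' \<Longrightarrow> u @ v @ w \<approx> u @ v' @ w"
  by (intro yb_append yb_refl)

lemma yb_equiv_shift_word: "v \<approx> w \<Longrightarrow> shift_word l v \<approx> shift_word l w"
proof (induction rule: yb_equiv.induct)
  case (yang_baxter k x y)
  then show ?case using yb_equiv.yang_baxter[of "k + l" x y] by simp
next
  case (far_commute k k' x y)
  then show ?case using yb_equiv.far_commute[of "k + l" "k' + l" x y] by simp
qed (auto intro: yb_sym yb_trans yb_append)

lemma yb_equiv_set_subset_iff:
  "v \<approx> w \<Longrightarrow> set v \<subseteq> {1..<N} \<times> X \<longleftrightarrow> set w \<subseteq> {1..<N} \<times> X"
  by (induction rule: yb_equiv.induct) auto

lemma yb_equiv_letter_commute:
  assumes "1 \<le> k" "x \<in> X" "set w \<subseteq> {c..<d} \<times> X" "k + 1 < c"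
  shows "(k, x) # w \<approx> w @ [(k, x)]"
  using assms(3)
proof (induction w)
  case (Cons letter w)
  then obtain l y where letter: "letter = (l, y)" "c \<le> l" "y \<in> X" by auto
  have "[(k, x), (l, y)] \<approx> [(l, y), (k, x)]"
    using assms letter by (intro far_commute) auto
  then have "(k, x) # (l, y) # w \<approx> (l, y) # (k, x) # w"
    using yb_equiv_context[of _ _ "[]" w] by fastforce
  also have "\<dots> \<approx> (l, y) # w @ [(k, x)]"
    using yb_equiv_context[of _ _ "[(l, y)]" "[]"] Cons by fastforce
  finally show ?case by (simp add: letter)
qed simp

lemma yb_equiv_append_commute:
  assumes "set v \<subseteq> {a..<b} \<times> X" "set w \<subseteq> {c..<d} \<times> X" "1 \<le> a" "b < c"
  shows "v @ w \<approx> w @ v"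
  using assms(1)
proof (induction v)
  case (Cons letter v)
  then obtain k x where letter: "letter = (k, x)" "a \<le> k" "k < b" "x \<in> X" by auto
  have "(k, x) # v @ w \<approx> (k, x) # w @ v"
    using yb_equiv_context[of _ _ "[(k, x)]" "[]"] Cons by fastforce
  also have "\<dots> \<approx> w @ (k, x) # v"
    using yb_equiv_context[OF yb_equiv_letter_commute[of k x w c d], of "[]" v] letter assms by simp
  finally show ?case by (simp add: letter)
qed simp

lemma word_prod_eq_if_yb_equiv:
  assumes "v \<approx> w"
    and "\<And>k x y. 1 \<le> k \<Longrightarrow> x \<in> X \<Longrightarrow> y \<in> X \<Longrightarrow> x * y \<in> X \<Longrightarrow>
      \<tau> (k + 1) x * \<tau> k (x * y) * \<tau> (k + 1) y = \<tau> k y * \<tau> (k + 1) (x * y) * \<tau> k x"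
    and "\<And>k l x y. 1 \<le> k \<Longrightarrow> k + 1 < l \<Longrightarrow> x \<in> X \<Longrightarrow> y \<in> X \<Longrightarrow> \<tau> k x * \<tau> l y = \<tau> l y * \<tau> k x"
  shows "word_prod \<tau> v = word_prod \<tau> w"
  using assms(1) by induction (use assms(2,3) in \<open>simp_all add: mult.assoc\<close>)

section \<open>The shuffle identity for words\<close>

context
  fixes s :: 'k
  assumes powers: "\<And>j. 1 \<le> j \<Longrightarrow> s ^ j \<in> X"
begin

lemma set_bracket_subset: "1 \<le> p \<Longrightarrow> set (bracket s a p n) \<subseteq> {a..<a + n} \<times> X"
  using powers by (auto simp: bracket_def)

lemma set_shuffle_word_subset: "set (shuffle_word s m n) \<subseteq> {1..<m + n} \<times> X"
  using powers by (auto simp: shuffle_word_def simp del: upt_Suc)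

lemma set_Sigma_word_subset: "set (Sigma_word s m) \<subseteq> {1..<m} \<times> X"
  using powers by (auto simp: Sigma_word_def)

text \<open>Two adjacent strands, crossing each other with parameter \<open>s\<^sup>c\<close>, are moved across a bundle of
  \<open>m\<close> strands.\<close>

lemma yb_equiv_bracket_exchange:
  assumes "1 \<le> a" "1 \<le> c" "1 \<le> p"
  shows "(a, s ^ c) # bracket s (a + 1) (c + p) m @ bracket s a p m \<approx>
    bracket s (a + 1) p m @ bracket s a (c + p) m @ [(a + m, s ^ c)]"
proof (induction m)
  case (Suc m)
  let ?x = "s ^ (p + m)" and ?y = "s ^ c" and ?xy = "s ^ (c + p + m)"
  let ?U = "bracket s (a + 1) (c + p) m" and ?V = "bracket s a p m"
    and ?U' = "bracket s (a + 1) p m" and ?V' = "bracket s a (c + p) m"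
  have commute: "bracket s a q m @ [(a + 1 + m, z)] \<approx> [(a + 1 + m, z)] @ bracket s a q m"
    if "1 \<le> q" "z \<in> X" for q z
    by (rule yb_equiv_append_commute[OF set_bracket_subset,
          where c = "a + 1 + m" and d = "a + 2 + m"])
      (use that assms in auto)
  have "(a, ?y) # bracket s (a + 1) (c + p) (Suc m) @ bracket s a p (Suc m) =
      ((a, ?y) # ?U) @ ([(a + 1 + m, ?xy)] @ ?V) @ [(a + m, ?x)]"
    by (simp add: bracket_Suc)
  also have "\<dots> \<approx> ((a, ?y) # ?U) @ (?V @ [(a + 1 + m, ?xy)]) @ [(a + m, ?x)]"
    using assms by (intro yb_equiv_context yb_sym[OF commute] powers) auto
  also have "\<dots> = [] @ ((a, ?y) # ?U @ ?V) @ [(a + 1 + m, ?xy), (a + m, ?x)]"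
    by simp
  also have "\<dots> \<approx> [] @ (?U' @ ?V' @ [(a + m, ?y)]) @ [(a + 1 + m, ?xy), (a + m, ?x)]"
    by (rule yb_equiv_context[OF Suc.IH])
  also have "\<dots> \<approx> (?U' @ ?V') @ [(a + 1 + m, ?x), (a + m, ?xy), (a + 1 + m, ?y)] @ []"
    using yb_equiv_context[OF yb_sym[OF yang_baxter[of "a + m" ?x ?y]], of "?U' @ ?V'" "[]"]
      powers assms by (simp add: power_add[symmetric] ac_simps)
  also have "\<dots> = ?U' @ (?V' @ [(a + 1 + m, ?x)]) @ [(a + m, ?xy), (a + 1 + m, ?y)]"
    by simp
  also have "\<dots> \<approx> ?U' @ ([(a + 1 + m, ?x)] @ ?V') @ [(a + m, ?xy), (a + 1 + m, ?y)]"
    using assms by (intro yb_equiv_context commute powers) auto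
  finally show ?case by (simp add: bracket_Suc)
qed simp

lemma yb_equiv_bracket_shuffle_exchange:
  assumes "1 \<le> c"
  shows "bracket s 1 c (m + n) @ shuffle_word s n m \<approx>
    shift_word 1 (shuffle_word s n m) @ bracket s 1 (c + n) m @ bracket s (m + 1) c n"
  using assms
proof (induction n arbitrary: c)
  case (Suc n)
  let ?S = "shuffle_word s n m" and ?L = "[(1, s ^ c)]"
    and ?U = "bracket s 2 (c + (n + 1)) m" and ?V = "bracket s 1 (n + 1) m"
    and ?W = "bracket s (m + 2) (c + 1) n"
  have commute_letter: "?L @ shift_word 2 ?S \<approx> shift_word 2 ?S @ ?L"
    by (rule yb_equiv_append_commute[OF _ set_shift_word_subset[OF set_shuffle_word_subset],
          where a = 1 and b = 2])
      (use Suc.prems powers in auto)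
  have commute_brackets: "?V @ ?W \<approx> ?W @ ?V"
    by (rule yb_equiv_append_commute[OF set_bracket_subset set_bracket_subset]) auto
  have "bracket s 1 c (m + Suc n) @ shuffle_word s (Suc n) m =
      ?L @ shift_word 1 (bracket s 1 (c + 1) (m + n) @ ?S) @ ?V"
    by (simp add: shuffle_word_Suc bracket_Suc_left numeral_2_eq_2)
  also have "\<dots> \<approx> ?L @ shift_word 1
      (shift_word 1 ?S @ bracket s 1 (c + 1 + n) m @ bracket s (m + 1) (c + 1) n) @ ?V"
    by (intro yb_equiv_context yb_equiv_shift_word Suc.IH) simp
  also have "\<dots> = (?L @ shift_word 2 ?S) @ ?U @ ?W @ ?V"
    by (simp add: numeral_2_eq_2)
  also have "\<dots> \<approx> (shift_word 2 ?S @ ?L) @ ?U @ ?V @ ?W"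
    by (rule yb_append[OF commute_letter yb_append[OF yb_refl yb_sym[OF commute_brackets]]])
  also have "\<dots> = shift_word 2 ?S @ ((1, s ^ c) # ?U @ ?V) @ ?W"
    by simp
  also have "\<dots> \<approx> shift_word 2 ?S @ (bracket s 2 (n + 1) m @ bracket s 1 (c + (n + 1)) m @
      [(m + 1, s ^ c)]) @ ?W"
    using yb_equiv_bracket_exchange[of 1 c "n + 1" m] Suc.prems
    by (intro yb_equiv_context) (simp add: numeral_2_eq_2)
  finally show ?case
    by (simp add: shuffle_word_Suc bracket_Suc_left numeral_2_eq_2)
qed simp

theorem yb_equiv_shuffle_word:
  "shuffle_word s (n + k) m @ shift_word m (shuffle_word s k n) \<approx>
    shuffle_word s k (m + n) @ shuffle_word s n m"
proof (induction k)
  case (Suc k)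
  let ?S = "shuffle_word s"
  let ?B = "bracket s 1 (n + k + 1) m" and ?C = "bracket s (m + 1) (k + 1) n"
  have commute: "?B @ shift_word (m + 1) (?S k n) \<approx> shift_word (m + 1) (?S k n) @ ?B"
    by (rule yb_equiv_append_commute[OF set_bracket_subset
          set_shift_word_subset[OF set_shuffle_word_subset]]) auto
  have "?S (n + Suc k) m @ shift_word m (?S (Suc k) n) =
      shift_word 1 (?S (n + k) m) @ (?B @ shift_word (m + 1) (?S k n)) @ ?C"
    by (simp add: shuffle_word_Suc add.commute)
  also have "\<dots> \<approx> shift_word 1 (?S (n + k) m) @ (shift_word (m + 1) (?S k n) @ ?B) @ ?C"
    by (rule yb_equiv_context[OF commute])
  also have "\<dots> = [] @ shift_word 1 (?S (n + k) m @ shift_word m (?S k n)) @ ?B @ ?C"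
    by simp
  also have "\<dots> \<approx> [] @ shift_word 1 (?S k (m + n) @ ?S n m) @ ?B @ ?C"
    by (intro yb_equiv_context yb_equiv_shift_word Suc.IH)
  also have "\<dots> = shift_word 1 (?S k (m + n)) @ (shift_word 1 (?S n m) @ ?B @ ?C) @ []"
    by simp
  also have "\<dots> \<approx> shift_word 1 (?S k (m + n)) @ (bracket s 1 (k + 1) (m + n) @ ?S n m) @ []"
    using yb_equiv_bracket_shuffle_exchange[of "k + 1" m n]
    by (intro yb_equiv_context[OF yb_sym]) (simp add: ac_simps)
  finally show ?case
    by (simp add: shuffle_word_Suc)
qed simp

theorem yb_equiv_Sigma_word:
  "Sigma_word s (m + n) \<approx> shuffle_word s n m @ Sigma_word s m @ shift_word m (Sigma_word s n)"
proof (induction n)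
  case (Suc n)
  let ?S = "shuffle_word s" and ?T = "Sigma_word s"
  have commute: "?T m @ shift_word m (?S 1 n) \<approx> shift_word m (?S 1 n) @ ?T m"
    by (rule yb_equiv_append_commute[OF set_Sigma_word_subset
          set_shift_word_subset[OF set_shuffle_word_subset]]) auto
  have "?T (m + Suc n) = ?S 1 (m + n) @ ?T (m + n) @ []"
    by (simp add: Sigma_word_Suc)
  also have "\<dots> \<approx> ?S 1 (m + n) @ (?S n m @ ?T m @ shift_word m (?T n)) @ []"
    by (rule yb_equiv_context[OF Suc.IH])
  also have "\<dots> = [] @ (?S 1 (m + n) @ ?S n m) @ ?T m @ shift_word m (?T n)"
    by simp
  also have "\<dots> \<approx> [] @ (?S (n + 1) m @ shift_word m (?S 1 n)) @ ?T m @ shift_word m (?T n)"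
    by (rule yb_equiv_context[OF yb_sym[OF yb_equiv_shuffle_word]])
  also have "\<dots> = ?S (n + 1) m @ (shift_word m (?S 1 n) @ ?T m) @ shift_word m (?T n)"
    by simp
  also have "\<dots> \<approx> ?S (n + 1) m @ (?T m @ shift_word m (?S 1 n)) @ shift_word m (?T n)"
    by (rule yb_equiv_context[OF yb_sym[OF commute]])
  finally show ?case
    by (simp add: Sigma_word_Suc)
qed simp

end

end

section \<open>Graded algebra structures on direct sums\<close>

lemma direct_sum_component: "u \<in> direct_sum P \<Longrightarrow> u j \<in> P j"
  by (simp add: direct_sum_def)

lemma direct_sum_mono: "(\<And>j. P j \<subseteq> Q j) \<Longrightarrow> direct_sum P \<subseteq> direct_sum Q"
  by (auto simp: direct_sum_def)

lemma direct_sum_bounded_support: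
  assumes "u \<in> direct_sum P"
  obtains M where "\<And>j. M < j \<Longrightarrow> u j = 0"
  using assms unfolding direct_sum_def finite_nat_set_iff_bounded_le
  by (auto simp: not_le[symmetric])

lemma direct_sumI_bounded_support:
  assumes "\<And>j. u j \<in> P j" "\<And>j. M < j \<Longrightarrow> u j = 0"
  shows "u \<in> direct_sum P"
proof -
  have "{j. u j \<noteq> 0} \<subseteq> {..M}"
    using assms(2) by (auto simp: not_less[symmetric])
  then show ?thesis
    using assms(1) by (auto simp: direct_sum_def intro: finite_subset)
qed

lemma homog_apply [simp]: "homog i t i = t" "j \<noteq> i \<Longrightarrow> homog i t j = 0"
  by (simp_all add: homog_def)

lemma homog_eq_0_iff [simp]: "homog i t = 0 \<longleftrightarrow> t = 0"
  by (auto simp: homog_def fun_eq_iff)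

lemma homog_in_direct_sum:
  assumes "\<And>j. 0 \<in> P j" "t \<in> P i"
  shows "homog i t \<in> direct_sum P"
  using assms by (intro direct_sumI_bounded_support[where M = i]) (simp_all add: homog_def)

lemma sum_homog_apply:
  assumes "finite I"
  shows "(\<Sum>i\<in>I. homog i (t i)) j = (if j \<in> I then t j else 0)"
  using assms by (induction I) (auto simp: homog_def)

lemma sum_homog_components:
  assumes "finite {i. u i \<noteq> 0}"
  shows "(\<Sum>i | u i \<noteq> 0. homog i (u i)) = u"
  using assms by (intro ext) (simp add: sum_homog_apply)

lemma homog_image_eq_direct_sum_Int:
  assumes "\<And>j. 0 \<in> Q j" "Q i \<subseteq> P i"
  shows "homog i ` Q i = direct_sum Q \<inter> homog i ` P i"
proof (intro equalityI subsetI)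
  fix u assume "u \<in> homog i ` Q i"
  then show "u \<in> direct_sum Q \<inter> homog i ` P i"
    using assms homog_in_direct_sum[of Q] by blast
next
  fix u assume "u \<in> direct_sum Q \<inter> homog i ` P i"
  then obtain t where "u = homog i t" "u \<in> direct_sum Q" by blast
  then show "u \<in> homog i ` Q i"
    using direct_sum_component[of u Q i] by auto
qed

lemma direct_sum_decomposition:
  fixes u :: "nat \<Rightarrow> 'a::ab_group_add"
  assumes "u \<in> direct_sum P"
  shows "\<exists>!c. (\<forall>i. c i \<in> homog i ` P i) \<and> finite {i. c i \<noteq> 0} \<and> u = (\<Sum>i | c i \<noteq> 0. c i)"
proof (rule ex1I[of _ "\<lambda>i. homog i (u i)"])
  show "(\<forall>i. homog i (u i) \<in> homog i ` P i) \<and> finite {i. homog i (u i) \<noteq> 0} \<and>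
      u = (\<Sum>i | homog i (u i) \<noteq> 0. homog i (u i))"
    using assms by (simp add: direct_sum_def sum_homog_components)
next
  fix c
  assume decomposition: "(\<forall>i. c i \<in> homog i ` P i) \<and> finite {i. c i \<noteq> 0} \<and> u = (\<Sum>i | c i \<noteq> 0. c i)"
  then have "\<forall>i. \<exists>t. c i = homog i t" by blast
  then obtain t where c_eq: "c = (\<lambda>i. homog i (t i))" by metis
  then have "u = t"
    using decomposition by (simp add: sum_homog_components)
  then show "c = (\<lambda>i. homog i (u i))"
    by (simp add: c_eq)
qed

lemma (in vector_space) subspace_direct_sum:
  assumes "\<And>j. subspace (P j)"
  shows "module.subspace (fun_scale scale) (direct_sum P)"
proof -
  interpret sequences: vector_space "fun_scale scale :: 'a \<Rightarrow> (nat \<Rightarrow> 'b) \<Rightarrow> _"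
    by (rule vector_space_fun_scale) unfold_locales
  show ?thesis
    unfolding sequences.subspace_def
  proof (intro conjI ballI allI)
    show "0 \<in> direct_sum P"
      using assms by (simp add: direct_sum_def subspace_0)
  next
    fix u v assume "u \<in> direct_sum P" "v \<in> direct_sum P"
    moreover have "{j. (u + v) j \<noteq> 0} \<subseteq> {j. u j \<noteq> 0} \<union> {j. v j \<noteq> 0}" by auto
    ultimately show "u + v \<in> direct_sum P"
      using assms by (auto simp: direct_sum_def subspace_add intro: finite_subset)
  next
    fix c u assume "u \<in> direct_sum P"
    moreover have "{j. fun_scale scale c u j \<noteq> 0} \<subseteq> {j. u j \<noteq> 0}"
      by (auto simp: fun_scale_def)
    ultimately show "fun_scale scale c u \<in> direct_sum P"
      using assms by (auto simp: direct_sum_def fun_scale_def subspace_scale intro: finite_subset)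
  qed
qed

lemma (in vector_space) subspace_homog_image:
  assumes "subspace S"
  shows "module.subspace (fun_scale scale) (homog i ` S)"
proof -
  interpret sequences: vector_space "fun_scale scale :: 'a \<Rightarrow> (nat \<Rightarrow> 'b) \<Rightarrow> _"
    by (rule vector_space_fun_scale) unfold_locales
  interpret homog: vector_space_pair scale "fun_scale scale :: 'a \<Rightarrow> (nat \<Rightarrow> 'b) \<Rightarrow> _"
    by unfold_locales
  have "Vector_Spaces.linear scale (fun_scale scale) (homog i)"
    unfolding Vector_Spaces.linear_iff using vector_space_axioms sequences.vector_space_axioms
    by (auto simp: homog_def fun_scale_def fun_eq_iff)
  then show ?thesis
    using assms by (rule homog.linear_subspace_image)
qed

definition convolution ::
    "(nat \<Rightarrow> nat \<Rightarrow> 'a \<Rightarrow> 'a \<Rightarrow> 'a::comm_monoid_add) \<Rightarrow> (nat \<Rightarrow> 'a) \<Rightarrow> (nat \<Rightarrow> 'a) \<Rightarrow> nat \<Rightarrow> 'a" where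
  "convolution \<mu> u v = (\<lambda>N. \<Sum>m\<le>N. \<mu> m (N - m) (u m) (v (N - m)))"

lemma sum_triangle_reassoc:
  fixes f :: "nat \<Rightarrow> nat \<Rightarrow> nat \<Rightarrow> 'a::comm_monoid_add"
  shows "(\<Sum>p\<le>N. \<Sum>m\<le>p. f m (p - m) (N - p)) = (\<Sum>m\<le>N. \<Sum>n\<le>N - m. f m n (N - m - n))"
proof -
  have "(\<Sum>(p, m)\<in>(SIGMA p:{..N}. {..p}). f m (p - m) (N - p)) =
      (\<Sum>(m, n)\<in>(SIGMA m:{..N}. {..N - m}). f m n (N - m - n))"
    by (rule sum.reindex_bij_witness[of _ "\<lambda>(m, n). (m + n, m)" "\<lambda>(p, m). (m, p - m)"]) auto
  then show ?thesis
    by (simp add: sum.Sigma)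
qed

locale graded_multiplication = vector_space scale
  for scale :: "'k::field \<Rightarrow> 'a::ab_group_add \<Rightarrow> 'a" +
  fixes P :: "nat \<Rightarrow> 'a set" and \<mu> :: "nat \<Rightarrow> nat \<Rightarrow> 'a \<Rightarrow> 'a \<Rightarrow> 'a" and e :: 'a
  assumes subspace_P: "subspace (P j)"
    and closed: "u \<in> P m \<Longrightarrow> v \<in> P n \<Longrightarrow> \<mu> m n u v \<in> P (m + n)"
    and add_left: "u \<in> P m \<Longrightarrow> u' \<in> P m \<Longrightarrow> v \<in> P n \<Longrightarrow> \<mu> m n (u + u') v = \<mu> m n u v + \<mu> m n u' v"
    and add_right: "u \<in> P m \<Longrightarrow> v \<in> P n \<Longrightarrow> v' \<in> P n \<Longrightarrow> \<mu> m n u (v + v') = \<mu> m n u v + \<mu> m n u v'"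
    and scale_left: "u \<in> P m \<Longrightarrow> v \<in> P n \<Longrightarrow> \<mu> m n (scale c u) v = scale c (\<mu> m n u v)"
    and scale_right: "u \<in> P m \<Longrightarrow> v \<in> P n \<Longrightarrow> \<mu> m n u (scale c v) = scale c (\<mu> m n u v)"
    and assoc: "u \<in> P m \<Longrightarrow> v \<in> P n \<Longrightarrow> w \<in> P k \<Longrightarrow>
      \<mu> (m + n) k (\<mu> m n u v) w = \<mu> m (n + k) u (\<mu> n k v w)"
    and unit_in: "e \<in> P 0"
    and unit_left: "u \<in> P n \<Longrightarrow> \<mu> 0 n e u = u"
    and unit_right: "u \<in> P n \<Longrightarrow> \<mu> n 0 u e = u"
begin

lemma zero_in: "0 \<in> P j"
  by (rule subspace_0[OF subspace_P])

lemma zero_left: "v \<in> P n \<Longrightarrow> \<mu> m n 0 v = 0"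
  using scale_left[OF zero_in, of v n m 0] by simp

lemma zero_right: "u \<in> P m \<Longrightarrow> \<mu> m n u 0 = 0"
  using scale_right[OF _ zero_in, of u m n 0] by simp

lemma sum_left:
  assumes "\<And>i. i \<in> I \<Longrightarrow> f i \<in> P m" "v \<in> P n"
  shows "\<mu> m n (\<Sum>i\<in>I. f i) v = (\<Sum>i\<in>I. \<mu> m n (f i) v)"
  using assms
  by (induction I rule: infinite_finite_induct)
    (simp_all add: zero_left add_left subspace_sum[OF subspace_P])

lemma sum_right:
  assumes "\<And>i. i \<in> I \<Longrightarrow> f i \<in> P n" "u \<in> P m"
  shows "\<mu> m n u (\<Sum>i\<in>I. f i) = (\<Sum>i\<in>I. \<mu> m n u (f i))"
  using assms
  by (induction I rule: infinite_finite_induct)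
    (simp_all add: zero_right add_right subspace_sum[OF subspace_P])

context
  fixes u v assumes u_in: "u \<in> direct_sum P" and v_in: "v \<in> direct_sum P"
begin

lemma convolution_summand_in: "m \<le> N \<Longrightarrow> \<mu> m (N - m) (u m) (v (N - m)) \<in> P N"
  using closed[of "u m" m "v (N - m)" "N - m"] u_in v_in by (simp add: direct_sum_component)

lemma convolution_in: "convolution \<mu> u v N \<in> P N"
  unfolding convolution_def by (intro subspace_sum[OF subspace_P] convolution_summand_in) simp

lemma convolution_closed: "convolution \<mu> u v \<in> direct_sum P"
proof -
  obtain A B where u_vanishes: "\<And>j. A < j \<Longrightarrow> u j = 0" and v_vanishes: "\<And>j. B < j \<Longrightarrow> v j = 0"
    using direct_sum_bounded_support u_in v_in by metis
  have "\<mu> m (N - m) (u m) (v (N - m)) = 0" if "A + B < N" "m \<le> N" for m N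
  proof (cases "A < m")
    case True
    then show ?thesis
      using u_vanishes v_in by (simp add: zero_left direct_sum_component)
  next
    case False
    with that have "B < N - m" by linarith
    then show ?thesis
      using v_vanishes u_in by (simp add: zero_right direct_sum_component)
  qed
  then show ?thesis
    using convolution_in
    by (intro direct_sumI_bounded_support[where M = "A + B"]) (simp_all add: convolution_def)
qed

lemma convolution_add_left:
  "u' \<in> direct_sum P \<Longrightarrow> convolution \<mu> (u + u') v = convolution \<mu> u v + convolution \<mu> u' v"
  using u_in v_in
  by (simp add: convolution_def fun_eq_iff add_left direct_sum_component sum.distrib)

lemma convolution_add_right:
  "v' \<in> direct_sum P \<Longrightarrow> convolution \<mu> u (v + v') = convolution \<mu> u v + convolution \<mu> u v'"
  using u_in v_in
  by (simp add: convolution_def fun_eq_iff add_right direct_sum_component sum.distrib)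

lemma convolution_scale:
  "convolution \<mu> (fun_scale scale c u) v = fun_scale scale c (convolution \<mu> u v)"
  "convolution \<mu> u (fun_scale scale c v) = fun_scale scale c (convolution \<mu> u v)"
  using u_in v_in by (simp_all add: convolution_def fun_eq_iff fun_scale_def scale_left scale_right
      direct_sum_component scale_sum_right)

end

lemma convolution_assoc:
  assumes u_in: "u \<in> direct_sum P" and v_in: "v \<in> direct_sum P" and w_in: "w \<in> direct_sum P"
  shows "convolution \<mu> (convolution \<mu> u v) w = convolution \<mu> u (convolution \<mu> v w)"
proof
  fix N
  define f where "f m n k = \<mu> m (n + k) (u m) (\<mu> n k (v n) (w k))" for m n k
  note components = direct_sum_component[OF u_in] direct_sum_component[OF v_in]
    direct_sum_component[OF w_in]
  have left: "\<mu> p k (convolution \<mu> u v p) (w k) = (\<Sum>m\<le>p. f m (p - m) k)" for p k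
  proof -
    have "\<mu> p k (\<mu> m (p - m) (u m) (v (p - m))) (w k) = f m (p - m) k" if "m \<le> p" for m
      using assoc[of "u m" m "v (p - m)" "p - m" "w k" k] that components by (simp add: f_def)
    then show ?thesis
      unfolding convolution_def
      by (subst sum_left) (simp_all add: convolution_summand_in[OF u_in v_in] components)
  qed
  have right: "\<mu> m k (u m) (convolution \<mu> v w k) = (\<Sum>n\<le>k. f m n (k - n))" for m k
    unfolding convolution_def
    by (subst sum_right) (simp_all add: f_def convolution_summand_in[OF v_in w_in] components)
  have "convolution \<mu> (convolution \<mu> u v) w N = (\<Sum>p\<le>N. \<Sum>m\<le>p. f m (p - m) (N - p))"
    unfolding convolution_def[of _ "convolution \<mu> u v"] by (simp only: left)
  also have "\<dots> = (\<Sum>m\<le>N. \<Sum>n\<le>N - m. f m n (N - m - n))"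
    by (rule sum_triangle_reassoc)
  also have "\<dots> = convolution \<mu> u (convolution \<mu> v w) N"
    unfolding convolution_def[of _ u] by (simp only: right)
  finally show "convolution \<mu> (convolution \<mu> u v) w N = convolution \<mu> u (convolution \<mu> v w) N" .
qed

lemma convolution_homog:
  assumes "t \<in> P i" "t' \<in> P j"
  shows "convolution \<mu> (homog i t) (homog j t') = homog (i + j) (\<mu> i j t t')"
proof
  fix N
  have "\<mu> m (N - m) (homog i t m) (homog j t' (N - m)) =
      (if m = i then homog (i + j) (\<mu> i j t t') N else 0)" if "m \<le> N" for m
    using assms that by (auto simp: homog_def zero_left zero_right zero_in)
  then show "convolution \<mu> (homog i t) (homog j t') N = homog (i + j) (\<mu> i j t t') N"
    by (simp add: convolution_def homog_def)
qed

lemma convolution_unit: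
  assumes "u \<in> direct_sum P"
  shows "convolution \<mu> (homog 0 e) u = u" and "convolution \<mu> u (homog 0 e) = u"
proof -
  have "\<mu> m (N - m) (homog 0 e m) (u (N - m)) = (if m = 0 then u N else 0)"
    and "m \<le> N \<Longrightarrow> \<mu> m (N - m) (u m) (homog 0 e (N - m)) = (if m = N then u N else 0)" for m N
    using direct_sum_component[OF assms]
    by (auto simp: homog_def unit_left unit_right zero_left zero_right)
  then show "convolution \<mu> (homog 0 e) u = u" and "convolution \<mu> u (homog 0 e) = u"
    by (simp_all add: convolution_def fun_eq_iff)
qed

theorem graded_algebra_direct_sum:
  "graded_algebra (fun_scale scale) (direct_sum P) (\<lambda>j. homog j ` P j) (convolution \<mu>) (homog 0 e)"
proof (intro graded_algebra.intro graded_algebra_axioms.intro vector_space_fun_scale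
    subspace_direct_sum subspace_homog_image direct_sum_decomposition subspace_P)
  show "convolution \<mu> u v \<in> homog (i + j) ` P (i + j)"
    if "u \<in> homog i ` P i" "v \<in> homog j ` P j" for u v i j
    using that by (auto simp: convolution_homog closed)
qed (use homog_in_direct_sum zero_in unit_in vector_space_axioms in
    \<open>auto simp: convolution_closed convolution_add_left convolution_add_right convolution_scale
      convolution_assoc convolution_unit\<close>)

lemma graded_multiplication_restrict:
  assumes "\<And>j. subspace (Q j)" "\<And>j. Q j \<subseteq> P j" "e \<in> Q 0"
    and "\<And>m n u v. u \<in> Q m \<Longrightarrow> v \<in> Q n \<Longrightarrow> \<mu> m n u v \<in> Q (m + n)"
  shows "graded_multiplication scale Q \<mu> e"
  by unfold_locales (use assms in \<open>simp_all add: subset_iff add_left add_right scale_left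
      scale_right assoc unit_left unit_right\<close>)

theorem graded_subalgebra_direct_sum:
  assumes "\<And>j. subspace (Q j)" "\<And>j. Q j \<subseteq> P j" "e \<in> Q 0"
    and "\<And>m n u v. u \<in> Q m \<Longrightarrow> v \<in> Q n \<Longrightarrow> \<mu> m n u v \<in> Q (m + n)"
  shows "graded_subalgebra (fun_scale scale) (direct_sum Q) (\<lambda>j. homog j ` Q j)
    (direct_sum P) (\<lambda>j. homog j ` P j) (convolution \<mu>) (homog 0 e)"
proof -
  interpret Q: graded_multiplication scale Q \<mu> e
    by (rule graded_multiplication_restrict[OF assms])
  show ?thesis
    unfolding graded_subalgebra_def
    using direct_sum_mono[of Q P, OF assms(2)] graded_algebra_direct_sum Q.graded_algebra_direct_sum
      homog_image_eq_direct_sum_Int[of Q _ P, OF Q.zero_in assms(2)] by blast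
qed

end

section \<open>Tensor products and local operators\<close>

locale tensor_powers = vector_space scale
  for scale :: "'k::field \<Rightarrow> 'v::ab_group_add \<Rightarrow> 'v"
begin

text \<open>Tensors are functions, but are only ever used as vectors here.\<close>

declare zero_fun_apply [simp del] plus_fun_apply [simp del]

abbreviation T :: "nat \<Rightarrow> ('k, 'v) tensor set" where
  "T n \<equiv> tensor_power scale n"

abbreviation pure :: "'v list \<Rightarrow> ('k, 'v) tensor" where
  "pure vs \<equiv> pure_tensor scale vs"

abbreviation tprod (infixl "\<otimes>" 70) where
  "t \<otimes> u \<equiv> tensor_prod scale t u"

abbreviation endomorphism2 :: "(('k, 'v) tensor \<Rightarrow> ('k, 'v) tensor) \<Rightarrow> bool" where
  "endomorphism2 f \<equiv> is_endomorphism tensor_scale (T 2) f"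

lemma subspace_T: "tensor.subspace (T n)"
  by (simp add: tensor_power_def)

lemma pure_in_T: "length vs = n \<Longrightarrow> pure vs \<in> T n"
  using pure_tensor_in_power[of scale vs] by simp

lemmas pure_prod_pure = tensor_prod_pure[OF vector_space_axioms]

text \<open>The map \<open>u \<mapsto> t \<otimes> u\<close> need not be linear on the whole ambient type, whose elements are not all
  tensors.\<close>

definition linear_on_T :: "nat \<Rightarrow> (('k, 'v) tensor \<Rightarrow> ('k, 'v) tensor) \<Rightarrow> bool" where
  "linear_on_T n g \<longleftrightarrow>
     (\<forall>c. \<forall>t\<in>T n. \<forall>u\<in>T n. g (tensor_scale c t + u) = tensor_scale c (g t) + g u)"

lemma linear_on_T_add:
  assumes "linear_on_T n g" "t \<in> T n" "u \<in> T n"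
  shows "g (t + u) = g t + g u"
proof -
  have "g (tensor_scale 1 t + u) = tensor_scale 1 (g t) + g u"
    using assms unfolding linear_on_T_def by blast
  then show ?thesis by simp
qed

lemma linear_on_T_0:
  assumes "linear_on_T n g"
  shows "g 0 = 0"
proof -
  have "g (0 + 0) = g 0 + g 0"
    by (rule linear_on_T_add[OF assms]) (rule tensor.subspace_0[OF subspace_T])+
  then show ?thesis by simp
qed

lemma linear_on_T_scale:
  assumes "linear_on_T n g" "t \<in> T n"
  shows "g (tensor_scale c t) = tensor_scale c (g t)"
proof -
  have "g (tensor_scale c t + 0) = tensor_scale c (g t) + g 0"
    using assms tensor.subspace_0[OF subspace_T] unfolding linear_on_T_def by blast
  then show ?thesis by (simp add: linear_on_T_0[OF assms(1)])
qed

lemma linear_on_T_eqI: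
  assumes "t \<in> T n" "linear_on_T n g" "linear_on_T n h"
    and "\<And>vs. length vs = n \<Longrightarrow> g (pure vs) = h (pure vs)"
  shows "g t = h t"
  using assms(1)
proof (induction rule: tensor_power_induct)
  case zero
  show ?case using assms(2,3) by (simp only: linear_on_T_0)
next
  case (step c vs t)
  have "f (tensor_scale c (pure vs) + t) = tensor_scale c (f (pure vs)) + f t"
    if "linear_on_T n f" for f
    using that step(1,2) pure_in_T unfolding linear_on_T_def by blast
  then show ?case
    using assms(2-4) step by simp
qed

lemma linear_on_T_closed:
  assumes "t \<in> T n" "linear_on_T n g" "\<And>vs. length vs = n \<Longrightarrow> g (pure vs) \<in> T r"
  shows "g t \<in> T r"
  using assms(1)
proof (induction rule: tensor_power_induct)
  case zero
  show ?case using assms(2) by (simp only: linear_on_T_0 tensor.subspace_0[OF subspace_T])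
next
  case (step c vs t)
  then have "g (tensor_scale c (pure vs) + t) = tensor_scale c (g (pure vs)) + g t"
    using assms(2) pure_in_T unfolding linear_on_T_def by blast
  then show ?case
    using step assms(3) by (simp add: subspace_T tensor.subspace_add tensor.subspace_scale)
qed

lemma linear_on_T_ident: "linear_on_T n (\<lambda>t. t)"
  by (simp add: linear_on_T_def)

lemma endomorphism2_closed: "endomorphism2 f \<Longrightarrow> t \<in> T 2 \<Longrightarrow> f t \<in> T 2"
  by (simp add: is_endomorphism_def)

lemma linear_on_T_endomorphism2: "endomorphism2 f \<Longrightarrow> linear_on_T 2 f"
  by (simp add: linear_on_T_def is_endomorphism_def tensor.subspace_scale[OF subspace_T])

lemma linear_on_T_local_op: "linear_on_T n g \<Longrightarrow> linear_on_T n (\<lambda>t. local_op scale f k (g t))"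
  by (simp add: linear_on_T_def local_op_def tensor_lift_linear)

lemma linear_on_T_tensor_prod_left: "linear_on_T n g \<Longrightarrow> linear_on_T n (\<lambda>t. g t \<otimes> u)"
  by (simp add: linear_on_T_def tensor_prod_left_linear)

lemma tensor_prod_right_linear:
  assumes t_in: "t \<in> T m" and u_in: "u \<in> T n" and u'_in: "u' \<in> T n"
  shows "t \<otimes> (tensor_scale c u + u') = tensor_scale c (t \<otimes> u) + t \<otimes> u'"
proof (rule linear_on_T_eqI[OF t_in])
  have "tensor_scale c u + u' \<in> T n"
    by (intro tensor.subspace_add tensor.subspace_scale subspace_T u_in u'_in)
  then show "pure vs \<otimes> (tensor_scale c u + u') = tensor_scale c (pure vs \<otimes> u) + pure vs \<otimes> u'" for vs
    using u_in u'_in by (simp add: tensor_prod_pure_left[OF vector_space_axioms] tensor_lift_linear)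
  show "linear_on_T m (\<lambda>t. tensor_scale c (t \<otimes> u) + t \<otimes> u')"
    by (simp add: linear_on_T_def tensor_prod_left_linear tensor.scale_right_distrib ac_simps)
qed (intro linear_on_T_tensor_prod_left linear_on_T_ident)

lemma linear_on_T_tensor_prod_right:
  assumes t_in: "t \<in> T m" and linear: "linear_on_T n g" and closed: "\<And>u. u \<in> T n \<Longrightarrow> g u \<in> T k"
  shows "linear_on_T n (\<lambda>u. t \<otimes> g u)"
  using linear tensor_prod_right_linear[OF t_in closed closed] by (simp add: linear_on_T_def)

lemma linear_on_T_tensor_prod: "t \<in> T m \<Longrightarrow> linear_on_T n ((\<otimes>) t)"
  by (rule linear_on_T_tensor_prod_right[OF _ linear_on_T_ident])

lemmas linear_on_T_intros =
  linear_on_T_ident linear_on_T_local_op linear_on_T_tensor_prod_left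

lemma tensor_prod_closed:
  assumes t_in: "t \<in> T m" and u_in: "u \<in> T n"
  shows "t \<otimes> u \<in> T (m + n)"
proof (rule linear_on_T_closed[OF t_in])
  show "pure vs \<otimes> u \<in> T (m + n)" if "length vs = m" for vs
    using tensor_prod_pure_closed[OF vector_space_axioms u_in, of vs] that by simp
qed (intro linear_on_T_intros)

lemma tensor_prod_assoc:
  assumes t_in: "t \<in> T m" and u_in: "u \<in> T n" and v_in: "v \<in> T k"
  shows "(t \<otimes> u) \<otimes> v = t \<otimes> (u \<otimes> v)"
proof (rule linear_on_T_eqI[OF t_in])
  fix xs :: "'v list" assume "length xs = m"
  note xs_in = pure_in_T[OF this]
  show "(pure xs \<otimes> u) \<otimes> v = pure xs \<otimes> (u \<otimes> v)"
  proof (rule linear_on_T_eqI[OF u_in])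
    fix ys :: "'v list" assume "length ys = n"
    note ys_in = pure_in_T[OF this]
    show "(pure xs \<otimes> pure ys) \<otimes> v = pure xs \<otimes> (pure ys \<otimes> v)"
    proof (rule linear_on_T_eqI[OF v_in])
      show "linear_on_T k (\<lambda>v. pure xs \<otimes> (pure ys \<otimes> v))"
        by (rule linear_on_T_tensor_prod_right[OF xs_in
              linear_on_T_tensor_prod[OF ys_in] tensor_prod_closed[OF ys_in]])
    qed (simp_all add: pure_prod_pure linear_on_T_tensor_prod[OF pure_tensor_in_power])
  next
    show "linear_on_T n (\<lambda>u. pure xs \<otimes> (u \<otimes> v))"
      by (rule linear_on_T_tensor_prod_right[OF xs_in _ tensor_prod_closed[OF _ v_in]])
        (intro linear_on_T_intros)
  qed (intro linear_on_T_tensor_prod_left linear_on_T_tensor_prod[OF xs_in])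
qed (intro linear_on_T_intros)+

lemma tensor_prod_unit:
  assumes "t \<in> T n"
  shows "pure [] \<otimes> t = t" and "t \<otimes> pure [] = t"
proof -
  show "pure [] \<otimes> t = t"
    by (rule linear_on_T_eqI[OF assms linear_on_T_tensor_prod[OF pure_in_T] linear_on_T_ident])
      (simp_all add: pure_prod_pure)
  show "t \<otimes> pure [] = t"
    by (rule linear_on_T_eqI[OF assms linear_on_T_tensor_prod_left[OF linear_on_T_ident]
          linear_on_T_ident]) (simp add: pure_prod_pure)
qed

lemma pure_split:
  assumes "length vs = n" "1 \<le> k" "k < n"
  obtains a b c where "a \<in> T (k - 1)" "b \<in> T 2" "c \<in> T (n - (k + 1))" "pure vs = a \<otimes> b \<otimes> c"
proof
  let ?a = "take (k - 1) vs" and ?b = "take 2 (drop (k - 1) vs)" and ?c = "drop (k + 1) vs"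
  have "drop 2 (drop (k - 1) vs) = ?c"
    using assms(2) by simp
  then have "vs = ?a @ ?b @ ?c"
    by (metis append_take_drop_id)
  then show "pure vs = pure ?a \<otimes> pure ?b \<otimes> pure ?c"
    by (simp only: pure_prod_pure append_assoc)
qed (use assms in \<open>auto intro!: pure_in_T\<close>)

lemma local_op_tensor_prod:
  assumes f_endo: "endomorphism2 f" and "1 \<le> k"
    and a_in: "a \<in> T (k - 1)" and b_in: "b \<in> T 2" and c_in: "c \<in> T n"
  shows "local_op scale f k (a \<otimes> b \<otimes> c) = a \<otimes> f b \<otimes> c"
proof (rule linear_on_T_eqI[OF a_in])
  fix xs :: "'v list" assume xs_length: "length xs = k - 1"
  note xs_in = pure_in_T[OF xs_length]
  show "local_op scale f k (pure xs \<otimes> b \<otimes> c) = pure xs \<otimes> f b \<otimes> c"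
  proof (rule linear_on_T_eqI[OF b_in])
    fix ys :: "'v list" assume ys_length: "length ys = 2"
    note ys_in = pure_in_T[OF ys_length]
    from ys_length obtain v w where ys_eq: "ys = [v, w]"
      by (auto simp: length_Suc_conv numeral_2_eq_2)
    show "local_op scale f k (pure xs \<otimes> pure ys \<otimes> c) = pure xs \<otimes> f (pure ys) \<otimes> c"
    proof (rule linear_on_T_eqI[OF c_in])
      fix zs :: "'v list"
      show "local_op scale f k (pure xs \<otimes> pure ys \<otimes> pure zs) = pure xs \<otimes> f (pure ys) \<otimes> pure zs"
        using local_op_pure[OF vector_space_axioms f_endo, of k "xs @ [v, w] @ zs"]
          \<open>1 \<le> k\<close> xs_length
        by (simp add: pure_prod_pure ys_eq nth_append_left nth_append_right)
    qed (intro linear_on_T_local_op linear_on_T_tensor_prod[OF tensor_prod_closed[OF xs_in ys_in]]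
        linear_on_T_tensor_prod[OF tensor_prod_closed[OF xs_in
            endomorphism2_closed[OF f_endo ys_in]]])+
  next
    show "linear_on_T 2 (\<lambda>b. pure xs \<otimes> f b \<otimes> c)"
      by (rule linear_on_T_tensor_prod_left, rule linear_on_T_tensor_prod_right[OF xs_in
            linear_on_T_endomorphism2[OF f_endo] endomorphism2_closed[OF f_endo]])
  qed (intro linear_on_T_intros linear_on_T_tensor_prod[OF xs_in])
qed (intro linear_on_T_intros)+

lemma local_op_closed:
  assumes f_endo: "endomorphism2 f" and k_range: "1 \<le> k" "k < n" and t_in: "t \<in> T n"
  shows "local_op scale f k t \<in> T n"
proof (rule linear_on_T_closed[OF t_in])
  fix vs :: "'v list" assume vs_length: "length vs = n"
  obtain a b c where factors: "a \<in> T (k - 1)" "b \<in> T 2" "c \<in> T (n - (k + 1))" "pure vs = a \<otimes> b \<otimes> c"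
    using pure_split[OF vs_length k_range] .
  have "a \<otimes> f b \<otimes> c \<in> T ((k - 1) + 2 + (n - (k + 1)))"
    by (intro tensor_prod_closed factors endomorphism2_closed[OF f_endo])
  then show "local_op scale f k (pure vs) \<in> T n"
    using local_op_tensor_prod[OF f_endo k_range(1) factors(1-3)] k_range factors(4) by simp
qed (intro linear_on_T_intros)

lemma local_op_tensor_prod_left:
  assumes f_endo: "endomorphism2 f" and k_range: "1 \<le> k" "k < m"
    and t_in: "t \<in> T m" and u_in: "u \<in> T n"
  shows "local_op scale f k (t \<otimes> u) = local_op scale f k t \<otimes> u"
proof (rule linear_on_T_eqI[OF t_in])
  fix vs :: "'v list" assume vs_length: "length vs = m"
  obtain a b c where factors: "a \<in> T (k - 1)" "b \<in> T 2" "c \<in> T (m - (k + 1))" "pure vs = a \<otimes> b \<otimes> c"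
    using pure_split[OF vs_length k_range] .
  have "local_op scale f k (a \<otimes> b \<otimes> c \<otimes> u) = local_op scale f k (a \<otimes> b \<otimes> (c \<otimes> u))"
    by (simp only: tensor_prod_assoc[OF tensor_prod_closed[OF factors(1,2)] factors(3) u_in])
  also have "\<dots> = a \<otimes> f b \<otimes> (c \<otimes> u)"
    by (rule local_op_tensor_prod[OF f_endo k_range(1) factors(1,2)
          tensor_prod_closed[OF factors(3) u_in]])
  also have "\<dots> = a \<otimes> f b \<otimes> c \<otimes> u"
    by (rule tensor_prod_assoc[symmetric,
          OF tensor_prod_closed[OF factors(1) endomorphism2_closed[OF f_endo factors(2)]]
            factors(3) u_in])
  also have "\<dots> = local_op scale f k (a \<otimes> b \<otimes> c) \<otimes> u"
    by (simp only: local_op_tensor_prod[OF f_endo k_range(1) factors(1-3)])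
  finally show "local_op scale f k (pure vs \<otimes> u) = local_op scale f k (pure vs) \<otimes> u"
    by (simp only: factors(4))
qed (intro linear_on_T_intros)+

lemma local_op_tensor_prod_right:
  assumes f_endo: "endomorphism2 f" and k_range: "1 \<le> k" "k < n"
    and t_in: "t \<in> T m" and u_in: "u \<in> T n"
  shows "local_op scale f (k + m) (t \<otimes> u) = t \<otimes> local_op scale f k u"
proof (rule linear_on_T_eqI[OF u_in])
  fix vs :: "'v list" assume vs_length: "length vs = n"
  obtain a b c where factors: "a \<in> T (k - 1)" "b \<in> T 2" "c \<in> T (n - (k + 1))" "pure vs = a \<otimes> b \<otimes> c"
    using pure_split[OF vs_length k_range] .
  have reassoc: "t \<otimes> (a \<otimes> b' \<otimes> c) = (t \<otimes> a) \<otimes> b' \<otimes> c" if "b' \<in> T 2" for b'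
    using tensor_prod_assoc[OF t_in tensor_prod_closed[OF factors(1) that] factors(3)]
      tensor_prod_assoc[OF t_in factors(1) that] by simp
  have "t \<otimes> a \<in> T (k + m - 1)"
    using tensor_prod_closed[OF t_in factors(1)] k_range(1) by (simp add: add.commute)
  then have "local_op scale f (k + m) (t \<otimes> (a \<otimes> b \<otimes> c)) = (t \<otimes> a) \<otimes> f b \<otimes> c"
    unfolding reassoc[OF factors(2)] using k_range(1)
    by (intro local_op_tensor_prod[OF f_endo _ _ factors(2,3)]) simp_all
  also have "\<dots> = t \<otimes> local_op scale f k (a \<otimes> b \<otimes> c)"
    by (simp only: local_op_tensor_prod[OF f_endo k_range(1) factors(1-3)]
        reassoc[OF endomorphism2_closed[OF f_endo factors(2)]])
  finally show "local_op scale f (k + m) (t \<otimes> pure vs) = t \<otimes> local_op scale f k (pure vs)"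
    by (simp only: factors(4))
qed (intro linear_on_T_intros linear_on_T_tensor_prod[OF t_in]
    linear_on_T_tensor_prod_right[OF t_in _ local_op_closed[OF f_endo k_range]])+

lemma local_op_commute:
  assumes f_endo: "endomorphism2 f" and g_endo: "endomorphism2 g"
    and kl_range: "1 \<le> k" "k + 1 < l" "l < n" and t_in: "t \<in> T n"
  shows "local_op scale f k (local_op scale g l t) = local_op scale g l (local_op scale f k t)"
proof (rule linear_on_T_eqI[OF t_in])
  fix vs :: "'v list" assume vs_length: "length vs = n"
  define a b where "a = pure (take (l - 1) vs)" and "b = pure (drop (l - 1) vs)"
  have a_in: "a \<in> T (l - 1)" and b_in: "b \<in> T (n - (l - 1))"
    using kl_range vs_length unfolding a_def b_def by (auto intro!: pure_in_T)
  have pure_vs: "pure vs = a \<otimes> b"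
    by (simp add: a_def b_def pure_prod_pure)
  have f_left: "local_op scale f k (a \<otimes> u) = local_op scale f k a \<otimes> u"
    if "u \<in> T (n - (l - 1))" for u
    by (rule local_op_tensor_prod_left[OF f_endo _ _ a_in that]) (use kl_range in auto)
  have g_right: "local_op scale g l (u \<otimes> b) = u \<otimes> local_op scale g 1 b" if "u \<in> T (l - 1)" for u
    using local_op_tensor_prod_right[OF g_endo, of 1 "n - (l - 1)" u "l - 1" b] that b_in kl_range
    by simp
  have "local_op scale f k a \<in> T (l - 1)" "local_op scale g 1 b \<in> T (n - (l - 1))"
    using kl_range a_in b_in by (simp_all add: local_op_closed f_endo g_endo)
  then show "local_op scale f k (local_op scale g l (pure vs)) =
      local_op scale g l (local_op scale f k (pure vs))"
    using a_in b_in by (simp only: pure_vs f_left g_right)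
qed (intro linear_on_T_intros)+

end

section \<open>b-shuffle algebras\<close>

locale yang_baxter_representation = tensor_powers scale
  for scale :: "'k::field \<Rightarrow> 'v::ab_group_add \<Rightarrow> 'v" +
  fixes X :: "'k set" and \<sigma> :: "'k \<Rightarrow> ('k, 'v) tensor \<Rightarrow> ('k, 'v) tensor"
  assumes endomorphism: "x \<in> X \<Longrightarrow> endomorphism2 (\<sigma> x)"
    and braid: "1 \<le> k \<Longrightarrow> x \<in> X \<Longrightarrow> y \<in> X \<Longrightarrow> x * y \<in> X \<Longrightarrow> k + 2 \<le> N \<Longrightarrow> t \<in> T N \<Longrightarrow>
      local_op scale (\<sigma> x) (k + 1) (local_op scale (\<sigma> (x * y)) k (local_op scale (\<sigma> y) (k + 1) t)) =
      local_op scale (\<sigma> y) k (local_op scale (\<sigma> (x * y)) (k + 1) (local_op scale (\<sigma> x) k t))"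
begin

abbreviation act :: "(nat \<times> 'k) list \<Rightarrow> ('k, 'v) tensor \<Rightarrow> ('k, 'v) tensor" where
  "act \<equiv> word_op (\<lambda>k x. local_op scale (\<sigma> x) k)"

text \<open>The letters that act on \<open>V\<^bsup>\<otimes>N\<^esup>\<close>; outside this range \<^const>\<open>local_op\<close> has junk values.\<close>

abbreviation letters :: "nat \<Rightarrow> (nat \<times> 'k) set" where
  "letters N \<equiv> {1..<N} \<times> X"

lemma act_linear:
  "act w (t + u) = act w t + act w u"
  "act w (tensor_scale c t) = tensor_scale c (act w t)"
  by (induction w) (auto simp: local_op_def tensor_lift_linear)

lemma linear_on_T_act: "linear_on_T n g \<Longrightarrow> linear_on_T n (\<lambda>t. act w (g t))"
  by (simp add: linear_on_T_def act_linear)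

lemma act_closed: "set w \<subseteq> letters N \<Longrightarrow> t \<in> T N \<Longrightarrow> act w t \<in> T N"
  by (induction w) (auto simp: local_op_closed endomorphism)

lemma act_tensor_prod_left:
  assumes "set w \<subseteq> letters m" "t \<in> T m" "u \<in> T n"
  shows "act w (t \<otimes> u) = act w t \<otimes> u"
  using assms(1)
proof (induction w)
  case (Cons letter w)
  then obtain k x where "letter = (k, x)" "1 \<le> k" "k < m" "x \<in> X" by auto
  with Cons assms(2,3) show ?case
    using local_op_tensor_prod_left[OF endomorphism _ _ act_closed] by simp
qed simp

lemma act_shift_word_tensor_prod:
  assumes "set w \<subseteq> letters n" "t \<in> T m" "u \<in> T n"
  shows "act (shift_word m w) (t \<otimes> u) = t \<otimes> act w u"
  using assms(1)
proof (induction w)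
  case (Cons letter w)
  then obtain k x where "letter = (k, x)" "1 \<le> k" "k < n" "x \<in> X" by auto
  with Cons assms(2,3) show ?case
    using local_op_tensor_prod_right[OF endomorphism _ _ assms(2) act_closed] by simp
qed simp

lemma act_eq_if_yb_equiv:
  assumes "yb_equiv X v w" "set v \<subseteq> letters N" "t \<in> T N"
  shows "act v t = act w t"
  using assms
proof (induction arbitrary: t rule: yb_equiv.induct)
  case (yb_sym v w)
  then show ?case
    using yb_equiv_set_subset_iff[of X v w N] by simp
next
  case (yb_trans u v w)
  then show ?case
    using yb_equiv_set_subset_iff[of X u v N] by simp
next
  case (yb_append v v' w w')
  then show ?case
    using act_closed[of w N t] by simp
next
  case (yang_baxter k x y)
  then show ?case
    using braid[of k x y N t] by simp
next
  case (far_commute k l x y)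
  then show ?case
    using local_op_commute[of "\<sigma> x" "\<sigma> y" k l N t] by (simp add: endomorphism)
qed simp

end

locale b_shuffle = yang_baxter_representation scale X \<sigma>
  for scale :: "'k::field \<Rightarrow> 'v::ab_group_add \<Rightarrow> 'v" and X \<sigma> +
  fixes s :: 'k
  assumes powers: "1 \<le> j \<Longrightarrow> s ^ j \<in> X"
begin

abbreviation mult :: "nat \<Rightarrow> nat \<Rightarrow> ('k, 'v) tensor \<Rightarrow> ('k, 'v) tensor \<Rightarrow> ('k, 'v) tensor" where
  "mult \<equiv> bshuffle_homog scale \<sigma> s"

lemmas shuffle_word_letters = set_shuffle_word_subset[OF powers]
  and Sigma_word_letters = set_Sigma_word_subset[OF powers]

lemma mult_closed:
  assumes "u \<in> T m" "v \<in> T n"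
  shows "mult m n u v \<in> T (m + n)"
  using act_closed[OF shuffle_word_letters[of n m]] tensor_prod_closed[OF assms]
  by (simp add: bshuffle_homog_def add.commute)

lemma mult_linear_left:
  "mult m n (u + u') v = mult m n u v + mult m n u' v"
  "mult m n (tensor_scale c u) v = tensor_scale c (mult m n u v)"
  by (simp_all add: bshuffle_homog_def tensor_prod_left_linear act_linear)

lemma mult_linear_right: "u \<in> T m \<Longrightarrow> linear_on_T n (mult m n u)"
  unfolding bshuffle_homog_def by (intro linear_on_T_act linear_on_T_tensor_prod)

lemma mult_assoc:
  assumes u_in: "u \<in> T m" and v_in: "v \<in> T n" and w_in: "w \<in> T k"
  shows "mult (m + n) k (mult m n u v) w = mult m (n + k) u (mult n k v w)"
proof -
  let ?S = "shuffle_word s"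
  have letters_nm: "set (?S n m) \<subseteq> letters (m + n)" and letters_kn: "set (?S k n) \<subseteq> letters (n + k)"
    using shuffle_word_letters[of n m] shuffle_word_letters[of k n] by (simp_all add: add.commute)
  have letters: "set (?S k (m + n) @ ?S n m) \<subseteq> letters (m + n + k)"
    using letters_nm shuffle_word_letters[of k "m + n"] by (auto simp: add.commute)
  have "mult (m + n) k (mult m n u v) w = act (?S k (m + n)) (act (?S n m) (u \<otimes> v) \<otimes> w)"
    by (simp only: bshuffle_homog_def)
  also have "\<dots> = act (?S k (m + n) @ ?S n m) (u \<otimes> v \<otimes> w)"
    by (simp only: word_op_simps
        act_tensor_prod_left[OF letters_nm tensor_prod_closed[OF u_in v_in] w_in])
  also have "\<dots> = act (?S (n + k) m @ shift_word m (?S k n)) (u \<otimes> v \<otimes> w)"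
    by (rule act_eq_if_yb_equiv[OF yb_sym[OF yb_equiv_shuffle_word[OF powers]] letters
          tensor_prod_closed[OF tensor_prod_closed[OF u_in v_in] w_in]])
  also have "\<dots> = act (?S (n + k) m) (u \<otimes> act (?S k n) (v \<otimes> w))"
    by (simp only: word_op_simps tensor_prod_assoc[OF u_in v_in w_in]
        act_shift_word_tensor_prod[OF letters_kn u_in tensor_prod_closed[OF v_in w_in]])
  finally show ?thesis
    by (simp only: bshuffle_homog_def)
qed

lemma mult_unit:
  assumes "u \<in> T n"
  shows "mult 0 n (pure []) u = u" and "mult n 0 u (pure []) = u"
  using tensor_prod_unit[OF assms] by (simp_all add: bshuffle_homog_def)

lemma Sigma_image_subset: "Sigma_image scale \<sigma> s j \<subseteq> T j"
  using act_closed[OF Sigma_word_letters] by (auto simp: Sigma_image_def)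

lemma subspace_Sigma_image: "tensor.subspace (Sigma_image scale \<sigma> s j)"
proof -
  interpret tensors: vector_space_pair "tensor_scale :: 'k \<Rightarrow> ('k, 'v) tensor \<Rightarrow> _"
      "tensor_scale :: 'k \<Rightarrow> ('k, 'v) tensor \<Rightarrow> _"
    by unfold_locales
  have "Vector_Spaces.linear tensor_scale tensor_scale (act (Sigma_word s j))"
    by (simp add: Vector_Spaces.linear_iff act_linear tensor.vector_space_axioms)
  then show ?thesis
    unfolding Sigma_image_def by (rule tensors.linear_subspace_image[OF _ subspace_T])
qed

lemma mult_Sigma_image:
  assumes "u \<in> Sigma_image scale \<sigma> s m" "v \<in> Sigma_image scale \<sigma> s n"
  shows "mult m n u v \<in> Sigma_image scale \<sigma> s (m + n)"
proof -
  let ?S = "Sigma_word s"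
  obtain a b where a_in: "a \<in> T m" and u_eq: "u = act (?S m) a"
    and b_in: "b \<in> T n" and v_eq: "v = act (?S n) b"
    using assms by (auto simp: Sigma_image_def)
  have "mult m n u v = act (shuffle_word s n m) (act (?S m) a \<otimes> act (?S n) b)"
    by (simp only: bshuffle_homog_def u_eq v_eq)
  also have "\<dots> = act (shuffle_word s n m @ ?S m @ shift_word m (?S n)) (a \<otimes> b)"
    by (simp only: word_op_simps act_shift_word_tensor_prod[OF Sigma_word_letters a_in b_in]
        act_tensor_prod_left[OF Sigma_word_letters a_in act_closed[OF Sigma_word_letters b_in]])
  also have "\<dots> = act (?S (m + n)) (a \<otimes> b)"
    by (rule act_eq_if_yb_equiv[OF yb_equiv_Sigma_word[OF powers] Sigma_word_letters
          tensor_prod_closed[OF a_in b_in], symmetric])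
  finally show ?thesis
    unfolding Sigma_image_def using tensor_prod_closed[OF a_in b_in] by blast
qed

sublocale graded: graded_multiplication tensor_scale "tensor_power scale" mult "pure []"
  by unfold_locales
    (simp_all add: subspace_T mult_closed mult_linear_left linear_on_T_add[OF mult_linear_right]
      linear_on_T_scale[OF mult_linear_right] mult_assoc pure_in_T mult_unit)

lemma bshuffle_eq_convolution: "bshuffle scale \<sigma> s = convolution mult"
  by (intro ext) (simp only: bshuffle_def convolution_def)

theorem bshuffle_graded_algebra:
  "graded_algebra (fun_scale tensor_scale)
    (direct_sum (tensor_power scale)) (\<lambda>j. homog j ` tensor_power scale j)
    (bshuffle scale \<sigma> s) (homog 0 (pure_tensor scale []))"
  unfolding bshuffle_eq_convolution by (rule graded.graded_algebra_direct_sum)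

theorem Sigma_image_graded_subalgebra:
  "graded_subalgebra (fun_scale tensor_scale)
    (direct_sum (Sigma_image scale \<sigma> s)) (\<lambda>j. homog j ` Sigma_image scale \<sigma> s j)
    (direct_sum (tensor_power scale)) (\<lambda>j. homog j ` tensor_power scale j)
    (bshuffle scale \<sigma> s) (homog 0 (pure_tensor scale []))"
proof -
  have "pure [] \<in> Sigma_image scale \<sigma> s 0"
    by (simp add: Sigma_image_def pure_in_T)
  then show ?thesis
    unfolding bshuffle_eq_convolution
    by (rule graded.graded_subalgebra_direct_sum[OF subspace_Sigma_image Sigma_image_subset _
          mult_Sigma_image])
qed

end

theorem mainTheorem1:
  fixes s :: "'k::field" and X :: "'k set"
    and scaleA :: "'k \<Rightarrow> 'a::{ring, monoid_mult} \<Rightarrow> 'a"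
    and \<tau> :: "nat \<Rightarrow> 'k \<Rightarrow> 'a"
    and scaleV :: "'k \<Rightarrow> 'v::ab_group_add \<Rightarrow> 'v"
    and \<sigma> :: "'k \<Rightarrow> ('k, 'v) tensor \<Rightarrow> ('k, 'v) tensor"
  assumes "s \<noteq> 0" and "0 \<notin> X" and "\<forall>j\<ge>1. s ^ j \<in> X"
  shows
    "(unital_algebra scaleA \<and>
      (\<forall>k\<ge>1. \<forall>x\<in>X. \<forall>y\<in>X. x * y \<in> X \<longrightarrow>
         \<tau> (k + 1) x * \<tau> k (x * y) * \<tau> (k + 1) y = \<tau> k y * \<tau> (k + 1) (x * y) * \<tau> k x) \<and>
      (\<forall>k\<ge>1. \<forall>l\<ge>1. \<forall>x\<in>X. \<forall>y\<in>X. \<bar>int k - int l\<bar> > 1 \<longrightarrow> \<tau> k x * \<tau> l y = \<tau> l y * \<tau> k x)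
      \<longrightarrow>
      (\<forall>m n k.
         word_prod \<tau> (shuffle_word s (n + k) m) * word_prod \<tau> (shift_word m (shuffle_word s k n)) =
         word_prod \<tau> (shuffle_word s k (m + n)) * word_prod \<tau> (shuffle_word s n m)))
     \<and>
     (vector_space scaleV \<and>
      (\<forall>x\<in>X. is_endomorphism tensor_scale (tensor_power scaleV 2) (\<sigma> x)) \<and>
      (\<forall>k\<ge>1. \<forall>x\<in>X. \<forall>y\<in>X. x * y \<in> X \<longrightarrow> (\<forall>N\<ge>k + 2. \<forall>t\<in>tensor_power scaleV N.
         local_op scaleV (\<sigma> x) (k + 1) (local_op scaleV (\<sigma> (x * y)) k (local_op scaleV (\<sigma> y) (k + 1) t)) =
         local_op scaleV (\<sigma> y) k (local_op scaleV (\<sigma> (x * y)) (k + 1) (local_op scaleV (\<sigma> x) k t))))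
      \<longrightarrow>
      graded_algebra (fun_scale tensor_scale)
        (direct_sum (tensor_power scaleV)) (\<lambda>j. homog j ` tensor_power scaleV j)
        (bshuffle scaleV \<sigma> s) (homog 0 (pure_tensor scaleV [])) \<and>
      graded_subalgebra (fun_scale tensor_scale)
        (direct_sum (Sigma_image scaleV \<sigma> s)) (\<lambda>j. homog j ` Sigma_image scaleV \<sigma> s j)
        (direct_sum (tensor_power scaleV)) (\<lambda>j. homog j ` tensor_power scaleV j)
        (bshuffle scaleV \<sigma> s) (homog 0 (pure_tensor scaleV [])))"
proof ((rule conjI; rule impI), goal_cases shuffle_identity b_shuffle_algebra)
  case shuffle_identity
  then have "word_prod \<tau> v = word_prod \<tau> w" if "yb_equiv X v w" for v w
    using that by (intro word_prod_eq_if_yb_equiv) auto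
  from this[OF yb_equiv_shuffle_word[OF assms(3)[rule_format]]] show ?case
    by simp
next
  case b_shuffle_algebra
  then interpret vector_space scaleV by blast
  interpret b_shuffle scaleV X \<sigma> s
    by unfold_locales (use b_shuffle_algebra assms(3) in blast)+
  show ?case
    using bshuffle_graded_algebra Sigma_image_graded_subalgebra by (rule conjI)
qed

end
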